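(* Let $d\geqslant 1$, let $(\Omega,\mathcal F,\mu)$ be a probability space and, for every $l\in\mathbb Z^d$, let $T^l:\Omega\to\Omega$ be a measure-preserving map, such that $T^i\circ T^j=T^{i+j}$ for all $i,j\in\mathbb Z^d$ (and $T^0$ is the identity). Let $p\geqslant 1$ and let $\mathcal M\subset\mathcal F$ be a $\sigma$-algebra such that $(T^{-i}\mathcal M)_{i\in\mathbb Z^d}$ is a commuting filtration. Suppose that, for every $s\in\{1,\dots,d\}$, $f\in\mathbb L^p(\Omega,\mathcal M,\mu)\ominus\mathbb L^p(\Omega,\bigcap_{k\geqslant 1}T_s^k\mathcal M,\mu)$ and $$\sum_{k\geqslant 1}k^{d-1}\left\lVert\mathbb E\left(f\mid T_s^k\mathcal M\right)\right\rVert_p<\infty .$$ Then $f$ admits the decomposition (almost surely) $$f=m+\sum_{\emptyset\subsetneq J\subsetneq\{1,\dots,d\}}\ \prod_{s\in J}(I-U_s)\,m_J+\prod_{s=1}^d(I-U_s)\,g,$$ where $m$, $g$ and $m_J$ ($\emptyset\subsetneq J\subsetneq\{1,\dots,d\}$) belong to $\mathbb L^p(\Omega,\mathcal M,\mu)$, and $(U^im)_{i\in\mathbb Z^d}$ and, for every $\emptyset\subsetneq J\subsetneq\{1,\dots,d\}$, $(U_{J^c}^{i}m_J)_{i\in\mathbb Z^{d-|J|}}$ are orthomartingale-difference random fields.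
   Context: Notation. For $s,t\in\mathbb Z^d$, $s\preceq t$ (equivalently $t\succeq s$) means $s_k\leqslant t_k$ for all $k\in\{1,\dots,d\}$, and $s\wedge t=(s_1\wedge t_1,\dots,s_d\wedge t_d)$. $\lVert Z\rVert_p^p=\int_\Omega|Z|^p\,d\mu$. For a $\sigma$-algebra $\mathcal N\subset\mathcal F$, $\mathbb L^p(\Omega,\mathcal N,\mu)$ is the space of $p$-integrable $\mathcal N$-measurable real random variables; for $\mathcal N_1,\mathcal N_2\subset\mathcal F$, $\mathbb L^p(\Omega,\mathcal N_1,\mu)\ominus\mathbb L^p(\Omega,\mathcal N_2,\mu)$ is the set of $Z\in\mathbb L^p(\Omega,\mathcal N_1,\mu)$ with $\mathbb E(Z\mid\mathcal N_2)=0$ a.s. $T^{-i}\mathcal M=\{(T^i)^{-1}(A):A\in\mathcal M\}$ for every $i\in\mathbb Z^d$. With $e_s$ the $s$-th canonical basis vector of $\mathbb Z^d$, $T_s=T^{e_s}$ and $T_s^k\mathcal M=T^{ke_s}\mathcal M$. $I$ is the identity operator, $U_sh=h\circ T_s$, $U^ih=h\circ T^i$ for $i\in\mathbb Z^d$. $J^c=\{1,\dots,d\}\setminus J$ and $|J|$ is the cardinality of $J$; for $i\in\mathbb Z^{d-|J|}$ (coordinates indexed by $J^c$), $U_{J^c}^i=\prod_{s\in J^c}U_s^{i_s}$. Commuting filtration: a family $(\mathcal G_i)_{i\in\mathbb Z^q}$ of $\sigma$-algebras with $\mathcal G_i\subset\mathcal G_j\subset\mathcal F$ whenever $i\preceq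 j$, and $\mathbb E(\mathbb E(Z\mid\mathcal G_s)\mid\mathcal G_t)=\mathbb E(Z\mid\mathcal G_{s\wedge t})$ a.s. for all $s,t\in\mathbb Z^q$ and all bounded random variables $Z$. Orthomartingale-difference random field: a random field $(X_k)_{k\in\mathbb Z^q}$ for which there is a commuting filtration $(\mathcal G_i)_{i\in\mathbb Z^q}$ such that $X_k\in\mathbb L^1(\Omega,\mathcal G_k,\mu)\ominus\mathbb L^1(\Omega,\mathcal G_l,\mu)$ for all $k,l\in\mathbb Z^q$ with $l\not\succeq k$. *)

theory Defs
  imports "HOL-Probability.Probability"
begin

text \<open>
  The lattice \<open>\<int>\<^sup>d\<close> is \<^typ>\<open>int ^ 'd\<close>, with coordinates indexed by the finite type \<open>'d\<close> and the
  componentwise order \<open>\<le>\<close> of the library.  The lattice of multi-indices with coordinates in a subset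
  \<open>K\<close> is represented by the vectors vanishing outside \<open>K\<close>; order and minimum are the
  componentwise ones in either view.
\<close>

definition lattice_on :: "'d::finite set \<Rightarrow> (int ^ 'd) set" where
  "lattice_on K = {i. \<forall>s. s \<notin> K \<longrightarrow> i $ s = 0}"

definition vmin :: "int ^ 'd::finite \<Rightarrow> int ^ 'd \<Rightarrow> int ^ 'd" where
  "vmin s t = (\<chi> k. min (s $ k) (t $ k))"

definition measure_preserving_action ::
    "'a measure \<Rightarrow> (int ^ 'd::finite \<Rightarrow> 'a \<Rightarrow> 'a) \<Rightarrow> bool" where
  "measure_preserving_action M T \<longleftrightarrow>
     (\<forall>l. T l \<in> measurable M M \<and> distr M M (T l) = M) \<and>
     (\<forall>i j. \<forall>\<omega>\<in>space M. T i (T j \<omega>) = T (i + j) \<omega>) \<and>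
     (\<forall>\<omega>\<in>space M. T 0 \<omega> = \<omega>)"

text \<open>
  Sub-\<open>\<sigma>\<close>-algebras are measures \<open>N\<close> with \<^prop>\<open>subalgebra M N\<close>; only \<open>space N\<close> and \<open>sets N\<close> matter.
  The image under \<open>T\<^sup>i\<close> is the preimage under \<open>T\<^sup>-\<^sup>i\<close>.
\<close>

definition shift_alg ::
    "'a measure \<Rightarrow> (int ^ 'd::finite \<Rightarrow> 'a \<Rightarrow> 'a) \<Rightarrow> 'a measure \<Rightarrow> int ^ 'd \<Rightarrow> 'a measure" where
  "shift_alg M T N i = vimage_algebra (space M) (T (- i)) N"

text \<open>The \<open>\<sigma>\<close>-algebra \<open>\<Inter>\<^bsub>k\<ge>1\<^esub> T\<^sub>s\<^sup>k \<M>\<close>.  An intersection of \<open>\<sigma>\<close>-algebras is one, so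
  \<^const>\<open>sigma\<close> adds no sets.\<close>

definition tail_alg ::
    "'a measure \<Rightarrow> (int ^ 'd::finite \<Rightarrow> 'a \<Rightarrow> 'a) \<Rightarrow> 'a measure \<Rightarrow> 'd \<Rightarrow> 'a measure" where
  "tail_alg M T N s = sigma (space M) (\<Inter>k\<in>{1::nat..}. sets (shift_alg M T N (axis s (int k))))"

definition Lp_norm :: "'a measure \<Rightarrow> real \<Rightarrow> ('a \<Rightarrow> real) \<Rightarrow> real" where
  "Lp_norm M p Z = (\<integral>\<omega>. \<bar>Z \<omega>\<bar> powr p \<partial>M) powr (1 / p)"

definition Lp_space :: "'a measure \<Rightarrow> 'a measure \<Rightarrow> real \<Rightarrow> ('a \<Rightarrow> real) set" where
  "Lp_space M N p = {Z. Z \<in> borel_measurable N \<and> integrable M (\<lambda>\<omega>. \<bar>Z \<omega>\<bar> powr p)}"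

definition Lp_ominus ::
    "'a measure \<Rightarrow> 'a measure \<Rightarrow> 'a measure \<Rightarrow> real \<Rightarrow> ('a \<Rightarrow> real) set" where
  "Lp_ominus M N1 N2 p = {Z \<in> Lp_space M N1 p. AE \<omega> in M. real_cond_exp M N2 Z \<omega> = 0}"

definition commuting_filtration ::
    "'a measure \<Rightarrow> 'd::finite set \<Rightarrow> (int ^ 'd \<Rightarrow> 'a measure) \<Rightarrow> bool" where
  "commuting_filtration M K G \<longleftrightarrow>
     (\<forall>i\<in>lattice_on K. subalgebra M (G i)) \<and>
     (\<forall>i\<in>lattice_on K. \<forall>j\<in>lattice_on K. i \<le> j \<longrightarrow> sets (G i) \<subseteq> sets (G j)) \<and>
     (\<forall>s\<in>lattice_on K. \<forall>t\<in>lattice_on K. \<forall>Z\<in>borel_measurable M.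
        (\<exists>B. \<forall>\<omega>\<in>space M. \<bar>Z \<omega>\<bar> \<le> B) \<longrightarrow>
        (AE \<omega> in M. real_cond_exp M (G t) (real_cond_exp M (G s) Z) \<omega>
                    = real_cond_exp M (G (vmin s t)) Z \<omega>))"

definition orthomartingale_diff ::
    "'a measure \<Rightarrow> 'd::finite set \<Rightarrow> (int ^ 'd \<Rightarrow> 'a \<Rightarrow> real) \<Rightarrow> bool" where
  "orthomartingale_diff M K X \<longleftrightarrow>
     (\<exists>G. commuting_filtration M K G \<and>
        (\<forall>k\<in>lattice_on K. \<forall>l\<in>lattice_on K. \<not> k \<le> l \<longrightarrow> X k \<in> Lp_ominus M (G k) (G l) 1))"

text \<open>
  Operators act on functions on \<open>space M\<close>, and their results are cut off outside it (\<^const>\<open>restrict\<close>),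
  since nothing is assumed about \<open>T\<close> there.  Thus the operators for different coordinates commute as
  functions, as \<^const>\<open>Finite_Set.fold\<close> requires for an unordered product; this is proved below.
\<close>

definition U_op ::
    "'a measure \<Rightarrow> (int ^ 'd::finite \<Rightarrow> 'a \<Rightarrow> 'a) \<Rightarrow> int ^ 'd \<Rightarrow> ('a \<Rightarrow> real) \<Rightarrow> 'a \<Rightarrow> real" where
  "U_op M T i h = (\<lambda>\<omega>\<in>space M. h (T i \<omega>))"

definition I_minus_U ::
    "'a measure \<Rightarrow> (int ^ 'd::finite \<Rightarrow> 'a \<Rightarrow> 'a) \<Rightarrow> 'd \<Rightarrow> ('a \<Rightarrow> real) \<Rightarrow> 'a \<Rightarrow> real" where
  "I_minus_U M T s h = (\<lambda>\<omega>\<in>space M. h \<omega> - U_op M T (axis s 1) h \<omega>)"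

definition prod_I_minus_U ::
    "'a measure \<Rightarrow> (int ^ 'd::finite \<Rightarrow> 'a \<Rightarrow> 'a) \<Rightarrow> 'd set \<Rightarrow> ('a \<Rightarrow> real) \<Rightarrow> 'a \<Rightarrow> real" where
  "prod_I_minus_U M T J h = Finite_Set.fold (I_minus_U M T) h J"

text \<open>\<open>U\<^sub>K\<^sup>i = \<Prod>\<^bsub>s\<in>K\<^esub> U\<^sub>s\<^bsup>i\<^sub>s\<^esup>\<close>, where \<open>U\<^sub>s\<^sup>n\<close> is composition with \<open>T\<close> at \<open>n e\<^sub>s\<close>.\<close>

definition U_on ::
    "'a measure \<Rightarrow> (int ^ 'd::finite \<Rightarrow> 'a \<Rightarrow> 'a) \<Rightarrow> 'd set \<Rightarrow> int ^ 'd \<Rightarrow> ('a \<Rightarrow> real) \<Rightarrow> 'a \<Rightarrow> real" where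
  "U_on M T K i h = Finite_Set.fold (\<lambda>s. U_op M T (axis s (i $ s))) h K"

lemma U_op_commute:
  assumes "measure_preserving_action M T"
  shows "U_op M T i (U_op M T j h) = U_op M T j (U_op M T i h)"
proof -
  have *: "T i (T j \<omega>) = T j (T i \<omega>)" "T i \<omega> \<in> space M" "T j \<omega> \<in> space M" if "\<omega> \<in> space M" for \<omega>
    using assms that by (auto simp: measure_preserving_action_def add.commute dest: measurable_space)
  show ?thesis by (rule ext) (simp add: U_op_def restrict_def *)
qed

lemma comp_fun_commute_U_op:
  assumes "measure_preserving_action M T"
  shows "comp_fun_commute (\<lambda>s. U_op M T (axis s (i $ s)))"
  by unfold_locales (simp add: fun_eq_iff U_op_commute[OF assms])

lemma comp_fun_commute_I_minus_U:
  assumes "measure_preserving_action M T"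
  shows "comp_fun_commute (I_minus_U M T)"
proof
  fix s t
  have *: "T i (T j \<omega>) = T j (T i \<omega>)" "T i \<omega> \<in> space M" if "\<omega> \<in> space M" for i j \<omega>
    using assms that by (auto simp: measure_preserving_action_def add.commute dest: measurable_space)
  show "I_minus_U M T t \<circ> I_minus_U M T s = I_minus_U M T s \<circ> I_minus_U M T t"
    by (intro ext) (simp add: I_minus_U_def U_op_def restrict_def *)
qed

end

theory Submission
  imports Defs
begin

text \<open>
  Write \<open>G\<^sub>i = T\<^bsup>-i\<^esup>\<M>\<close>, \<open>E\<^sub>i = \<E>(\<cdot> | G\<^sub>i)\<close>, and let \<open>1\<^sub>K\<close> be the indicator vector of a set \<open>K\<close> of
  coordinates.  Put \<open>a\<^sub>k = E\<^sub>0(U\<^sup>k f)\<close> for \<open>k \<in> \<nat>\<^sup>d\<close> and \<open>h = \<Sum>\<^sub>k a\<^sub>k\<close>.  Since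
  \<open>\<parallel>a\<^sub>k\<parallel>\<^sub>p \<le> \<parallel>\<E>(f | T\<^sub>s\<^sup>n \<M>)\<parallel>\<^sub>p\<close> with \<open>n = k\<^sub>s\<close> for every \<open>s\<close>, and since \<open>O(n\<^bsup>d-1\<^esup>)\<close> indices \<open>k\<close> have
  maximal coordinate \<open>n\<close>, the hypothesis makes the series converge in \<open>L\<^sup>p\<close>.  From
  \<open>E\<^sub>0 U\<^bsup>1_K\<^esup> a\<^sub>k = a\<^bsub>k + 1_K\<^esub>\<close>, telescoping in every coordinate gives
  \<open>f = \<Sum>\<^sub>K (-1)\<^bsup>|K|\<^esup> E\<^sub>0 U\<^bsup>1_K\<^esup> h = \<Sum>\<^sub>K (-1)\<^bsup>|K|\<^esup> U\<^bsup>1_K\<^esup> E\<^bsub>-1_K\<^esub> h\<close>.  With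
  \<open>m\<^sub>J = \<Prod>\<^bsub>s \<notin> J\<^esub> (I - E\<^bsub>-e_s\<^esub>) \<Prod>\<^bsub>s \<in> J\<^esub> E\<^bsub>-e_s\<^esub> h = \<Sum>\<^bsub>B \<subseteq> J^c\<^esub> (-1)\<^bsup>|B|\<^esup> E\<^bsub>-1_(B \<union> J)\<^esub> h\<close>
  (so \<open>m\<close> is the case \<open>J = {}\<close> and \<open>g\<close> that of the full set), expanding \<open>\<Sum>\<^sub>J \<Prod>\<^bsub>s \<in> J\<^esub> (I - U\<^sub>s) m\<^sub>J\<close> and cancelling over
  \<open>K \<subseteq> J \<subseteq> B \<union> J\<close> leaves exactly this sum.  If \<open>j\<^sub>s < 0\<close> for some \<open>s \<notin> J\<close>, then
  \<open>E\<^sub>j E\<^bsub>-1_C\<^esub> = E\<^bsub>j \<and> -1_C\<^esub>\<close> does not depend on whether \<open>s \<in> C\<close>, so the terms of \<open>E\<^sub>j m\<^sub>J\<close> cancel in pairs.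
\<close>

subsection \<open>Alternating sums over subsets and cubes\<close>

text \<open>Passing to the complement \<open>C - J\<close> gives the expansion of (1 - 1)^|C - K|,
  which vanishes unless \<open>K = C\<close>.\<close>

lemma sum_alternating_between:
  fixes K C :: "'d::finite set"
  assumes "K \<subseteq> C"
  shows "(\<Sum>J | K \<subseteq> J \<and> J \<subseteq> C. (-1::real) ^ card (C - J)) = of_bool (K = C)"
proof (cases "K = C")
  case True
  then have "{J. K \<subseteq> J \<and> J \<subseteq> C} = {C}" by auto
  then show ?thesis using True by simp
next
  case False
  have "(\<Sum>J | K \<subseteq> J \<and> J \<subseteq> C. (-1::real) ^ card (C - J)) = (\<Sum>B\<in>Pow (C - K). (-1) ^ card B)"
    by (rule sum.reindex_bij_witness[of _ "\<lambda>B. C - B" "\<lambda>J. C - J"]) (use assms in auto)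
  also have "\<dots> = (\<Prod>x\<in>C - K. 1 - 1)"
    by (subst prod_diff_conv_sum) auto
  also have "\<dots> = 0" using assms False by auto
  finally show ?thesis using False by simp
qed

text \<open>The combinatorial core of the decomposition. With \<open>C = B \<union> J\<close>, the
  sets \<open>J\<close> between \<open>K\<close> and \<open>C\<close> are summed first, and their
  signs cancel unless \<open>K = C\<close>. It is applied with \<open>\<beta> K C\<close> the value
  of E(-1_C) h at the image of a point under T^(1_K).\<close>

lemma sum_alternating_nested:
  fixes \<beta> :: "'d::finite set \<Rightarrow> 'd set \<Rightarrow> real"
  shows "(\<Sum>J\<in>UNIV. \<Sum>K\<in>Pow J. (-1) ^ card K * (\<Sum>B\<in>Pow (- J). (-1) ^ card B * \<beta> K (B \<union> J)))
    = (\<Sum>K\<in>UNIV. (-1) ^ card K * \<beta> K K)"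
proof -
  have "(\<Sum>B\<in>Pow (- J). (-1) ^ card B * \<beta> K (B \<union> J))
      = (\<Sum>C | J \<subseteq> C. (-1) ^ card (C - J) * \<beta> K C)" for J K
    by (rule sum.reindex_bij_witness[of _ "\<lambda>C. C - J" "\<lambda>B. B \<union> J"])
      (auto simp: Un_Diff Diff_triv disjoint_eq_subset_Compl)
  then have "(\<Sum>J\<in>UNIV. \<Sum>K\<in>Pow J. (-1) ^ card K * (\<Sum>B\<in>Pow (- J). (-1) ^ card B * \<beta> K (B \<union> J)))
    = (\<Sum>J\<in>UNIV. \<Sum>K | K \<subseteq> J. \<Sum>C | J \<subseteq> C. (-1) ^ card K * (-1) ^ card (C - J) * \<beta> K C)"
    by (simp add: Pow_def sum_distrib_left mult.assoc)
  \<comment> \<open>Indicators make the three ranges independent, so that the sums can be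
    exchanged.\<close>
  also have "\<dots> = (\<Sum>J\<in>UNIV. \<Sum>K\<in>UNIV. \<Sum>C\<in>UNIV.
      of_bool (K \<subseteq> J \<and> J \<subseteq> C) * ((-1) ^ card K * (-1) ^ card (C - J) * \<beta> K C))"
    by (intro sum.cong refl sum.mono_neutral_cong_left) (auto intro!: sum.mono_neutral_cong_left)
  also have "\<dots> = (\<Sum>K\<in>UNIV. \<Sum>C\<in>UNIV. \<Sum>J\<in>UNIV.
      of_bool (K \<subseteq> J \<and> J \<subseteq> C) * ((-1) ^ card K * (-1) ^ card (C - J) * \<beta> K C))"
    by (subst sum.swap) (intro sum.cong refl sum.swap)
  also have "\<dots> = (\<Sum>K\<in>UNIV. \<Sum>C\<in>UNIV. (-1) ^ card K * \<beta> K C *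
      (\<Sum>J | K \<subseteq> J \<and> J \<subseteq> C. (-1) ^ card (C - J)))"
    unfolding sum_distrib_left
    by (intro sum.cong refl sum.mono_neutral_cong_right) auto
  also have "\<dots> = (\<Sum>K\<in>UNIV. \<Sum>C\<in>UNIV. if C = K then (-1) ^ card K * \<beta> K C else 0)"
  proof (intro sum.cong refl)
    fix K C :: "'d set"
    show "(-1) ^ card K * \<beta> K C * (\<Sum>J | K \<subseteq> J \<and> J \<subseteq> C. (-1) ^ card (C - J))
      = (if C = K then (-1) ^ card K * \<beta> K C else 0)"
    proof (cases "K \<subseteq> C")
      case False
      then have "{J. K \<subseteq> J \<and> J \<subseteq> C} = {}" "C \<noteq> K" by auto
      then show ?thesis by (simp only: sum.empty) simp
    qed (simp add: sum_alternating_between eq_commute)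
  qed
  also have "\<dots> = (\<Sum>K\<in>UNIV. (-1) ^ card K * \<beta> K K)" by simp
  finally show ?thesis .
qed

lemma sum_Pow_insert:
  assumes "finite A" "s \<notin> A"
  shows "(\<Sum>B\<in>Pow (insert s A). g B) = (\<Sum>B\<in>Pow A. g B + g (insert s B) :: real)"
proof -
  have "(\<Sum>B\<in>Pow (insert s A). g B) = (\<Sum>B\<in>Pow A. g B) + (\<Sum>B\<in>insert s ` Pow A. g B)"
    unfolding Pow_insert by (rule sum.union_disjoint) (use assms in auto)
  also have "(\<Sum>B\<in>insert s ` Pow A. g B) = (\<Sum>B\<in>Pow A. g (insert s B))"
    by (subst sum.reindex) (use assms in \<open>auto intro!: inj_onI\<close>)
  finally show ?thesis by (simp add: sum.distrib)
qed

text \<open>\<open>B\<close> and \<open>insert s B\<close> carry opposite signs and the same value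
  of \<open>\<phi>\<close>, so the terms cancel in pairs.\<close>

lemma sum_Pow_alternating_eq_0:
  fixes \<phi> :: "'b set \<Rightarrow> real"
  assumes "finite A" "s \<in> A" and \<phi>: "\<And>B. B \<subseteq> A \<Longrightarrow> \<phi> (insert s B) = \<phi> B"
  shows "(\<Sum>B\<in>Pow A. (-1) ^ card B * \<phi> B) = 0"
proof -
  have "(\<Sum>B\<in>Pow (insert s (A - {s})). (-1) ^ card B * \<phi> B)
      = (\<Sum>B\<in>Pow (A - {s}). (-1) ^ card B * \<phi> B + (-1) ^ card (insert s B) * \<phi> (insert s B))"
    by (rule sum_Pow_insert) (use assms in auto)
  also have "\<dots> = (\<Sum>B\<in>Pow (A - {s}). 0)"
  proof (rule sum.cong[OF refl])
    fix B assume B: "B \<in> Pow (A - {s})"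
    then have "card (insert s B) = Suc (card B)"
      using assms(1) by (intro card_insert_disjoint) (auto intro: finite_subset)
    moreover have "\<phi> (insert s B) = \<phi> B" using B by (intro \<phi>) auto
    ultimately show "(-1) ^ card B * \<phi> B + (-1) ^ card (insert s B) * \<phi> (insert s B) = 0"
      by simp
  qed
  finally show ?thesis using assms(2) by (simp add: insert_absorb)
qed

section \<open>Cubes and shells of multi-indices, and telescoping over a cube\<close>

definition cube :: "nat \<Rightarrow> ('d::finite \<Rightarrow> nat) set" where
  "cube n = {k. \<forall>s. k s < n}"

text \<open>The multi-indices whose largest coordinate is exactly \<open>n\<close>; grouping by
  shells turns the d-fold series into a series over the naturals.\<close>

definition shell :: "nat \<Rightarrow> ('d::finite \<Rightarrow> nat) set" where
  "shell n = cube (Suc n) - cube n"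

lemma cube_PiE: "cube n = (\<Pi>\<^sub>E s\<in>UNIV. {..<n})"
  by (auto simp: cube_def PiE_def Pi_def)

lemma finite_cube [simp]: "finite (cube n)"
  by (simp add: cube_PiE finite_PiE)

lemma finite_shell [simp]: "finite (shell n)"
  by (simp add: shell_def)

lemma card_cube: "card (cube n :: ('d::finite \<Rightarrow> nat) set) = n ^ CARD('d)"
  by (simp add: cube_PiE card_PiE)

lemma cube_subset_Suc: "cube n \<subseteq> cube (Suc n)"
  by (auto simp: cube_def less_Suc_eq)

lemma sum_cube_eq_sum_shell: "sum \<alpha> (cube n) = (\<Sum>i<n. sum \<alpha> (shell i))" for \<alpha> :: "('d::finite \<Rightarrow> nat) \<Rightarrow> real"
proof (induction n)
  case (Suc n)
  have "sum \<alpha> (cube (Suc n)) = sum \<alpha> (shell n) + sum \<alpha> (cube n)"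
    unfolding shell_def by (rule sum.subset_diff[OF cube_subset_Suc]) simp
  then show ?case using Suc by simp
qed (simp add: cube_def)

lemma shell_attains: "k \<in> shell n \<Longrightarrow> \<exists>s. k s = n"
  by (auto simp: shell_def cube_def less_Suc_eq)

text \<open>A discrete mean-value bound. The induction runs on the additive form, which avoids
  subtracting powers.\<close>

lemma power_Suc_diff_le: "(Suc n) ^ d - n ^ d \<le> d * Suc n ^ (d - 1)"
proof -
  have "Suc n ^ d \<le> n ^ d + d * Suc n ^ (d - 1)"
  proof (induction d)
    case (Suc d)
    have "Suc n ^ Suc d = Suc n * Suc n ^ d" by simp
    also have "\<dots> \<le> Suc n * (n ^ d + d * Suc n ^ (d - 1))" by (rule mult_le_mono2[OF Suc])
    also have "\<dots> = n ^ Suc d + n ^ d + d * (Suc n * Suc n ^ (d - 1))" by (simp add: algebra_simps)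
    \<comment> \<open>For \<open>d = 0\<close> the factor \<open>d\<close> kills the term, so the
      truncated exponent \<open>d - 1\<close> does no harm.\<close>
    also have "\<dots> = n ^ Suc d + n ^ d + d * Suc n ^ d" by (cases d) auto
    also have "\<dots> \<le> n ^ Suc d + Suc d * Suc n ^ (Suc d - 1)"
      using power_mono[of n "Suc n" d] by simp
    finally show ?case .
  qed simp
  then show ?thesis by linarith
qed

text \<open>This growth rate is what the weight k^(d-1) in the summability hypothesis
  absorbs.\<close>

lemma card_shell_le: "card (shell n :: ('d::finite \<Rightarrow> nat) set) \<le> CARD('d) * Suc n ^ (CARD('d) - 1)"
proof -
  have "card (shell n :: ('d \<Rightarrow> nat) set) = Suc n ^ CARD('d) - n ^ CARD('d)"
    unfolding shell_def by (subst card_Diff_subset) (simp_all add: cube_subset_Suc card_cube)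
  then show ?thesis using power_Suc_diff_le[of n "CARD('d)"] by simp
qed

lemma prod_of_bool: "finite A \<Longrightarrow> (\<Prod>s\<in>A. of_bool (P s)) = (of_bool (\<forall>s\<in>A. P s) :: real)"
  by (induction A rule: finite_induct) auto

text \<open>Multiply out: \<open>K\<close> is the set of coordinates from which the second term of
  the difference is chosen.\<close>

lemma prod_of_bool_diff:
  fixes P Q :: "'d::finite \<Rightarrow> bool"
  shows "(\<Prod>s\<in>UNIV. of_bool (P s) - of_bool (Q s) :: real)
    = (\<Sum>K\<in>UNIV. (-1) ^ card K * of_bool (\<forall>s. if s \<in> K then Q s else P s))"
proof -
  have *: "of_bool (\<forall>s. if s \<in> K then Q s else P s)
      = (\<Prod>s\<in>K. of_bool (Q s)) * (\<Prod>s\<in>UNIV - K. of_bool (P s) :: real)" for K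
    by (simp add: prod_of_bool of_bool_conj[symmetric] del: of_bool_conj)
      (auto split: if_splits)
  show ?thesis by (simp add: prod_diff_conv_sum * mult.assoc)
qed

text \<open>Telescoping in all coordinates at once. The coefficient of \<open>\<alpha> k\<close> on
  the left is the product over \<open>s\<close> of [k s < n] - [1 <= k s], and each factor equals
  [k s = 0] - [k s = n] when 0 <= k s <= n; hence only the corners of the cube survive.\<close>

lemma sum_cube_telescope:
  fixes \<alpha> :: "('d::finite \<Rightarrow> nat) \<Rightarrow> real"
  assumes "n > 0"
  shows "(\<Sum>K\<in>UNIV. (-1) ^ card K * (\<Sum>k\<in>cube n. \<alpha> (\<lambda>s. k s + of_bool (s \<in> K))))
    = (\<Sum>A\<in>UNIV. (-1) ^ card A * \<alpha> (\<lambda>s. n * of_bool (s \<in> A)))"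
proof -
  have filter: "(\<Sum>k | k \<in> A \<and> P k. \<alpha> k) = (\<Sum>k\<in>A. of_bool (P k) * \<alpha> k)" if "finite A" for A P
    by (intro sum.mono_neutral_cong_left) (use that in auto)
  \<comment> \<open>After the shift, coordinates in \<open>K\<close> run from 1 to \<open>n\<close>
    and the others from 0 to \<open>n - 1\<close>, so one common cube with indicators serves for all
    \<open>K\<close>.\<close>
  have L: "(\<Sum>k\<in>cube n. \<alpha> (\<lambda>s. k s + of_bool (s \<in> K)))
      = (\<Sum>k\<in>cube (Suc n). of_bool (\<forall>s. if s \<in> K then 1 \<le> k s else k s < n) * \<alpha> k)" for K
  proof -
    have "(\<Sum>k\<in>cube n. \<alpha> (\<lambda>s. k s + of_bool (s \<in> K)))
      = (\<Sum>k | k \<in> cube (Suc n) \<and> (\<forall>s. if s \<in> K then 1 \<le> k s else k s < n). \<alpha> k)"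
    proof (rule sum.reindex_bij_witness[of _ "\<lambda>k s. k s - of_bool (s \<in> K)" "\<lambda>k s. k s + of_bool (s \<in> K)"])
      fix k assume "k \<in> {k \<in> cube (Suc n). \<forall>s. if s \<in> K then 1 \<le> k s else k s < n}"
      then have k: "k s < Suc n" "if s \<in> K then 1 \<le> k s else k s < n" for s
        unfolding cube_def by blast+
      show "(\<lambda>s. k s - of_bool (s \<in> K) + of_bool (s \<in> K)) = k"
      proof
        fix s show "k s - of_bool (s \<in> K) + of_bool (s \<in> K) = k s" using k(2)[of s] by (auto split: if_splits)
      qed
      show "(\<lambda>s. k s - of_bool (s \<in> K)) \<in> cube n"
        unfolding cube_def
      proof (intro CollectI allI)
        fix s show "k s - of_bool (s \<in> K) < n" using k[of s] by (auto split: if_splits)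
      qed
    qed (auto simp: cube_def intro: Suc_lessI less_SucI)
    also have "\<dots> = (\<Sum>k\<in>cube (Suc n). of_bool (\<forall>s. if s \<in> K then 1 \<le> k s else k s < n) * \<alpha> k)"
      by (rule filter) simp
    finally show ?thesis .
  qed
  have R: "\<alpha> (\<lambda>s. n * of_bool (s \<in> A))
      = (\<Sum>k\<in>cube (Suc n). of_bool (\<forall>s. if s \<in> A then k s = n else k s = 0) * \<alpha> k)" for A
  proof -
    have "(\<forall>s. if s \<in> A then k s = n else k s = 0) \<longleftrightarrow> k = (\<lambda>s. n * of_bool (s \<in> A))" for k
    proof -
      have "(if s \<in> A then k s = n else k s = 0) \<longleftrightarrow> k s = n * of_bool (s \<in> A)" for s by simp
      then show ?thesis by (simp only: fun_eq_iff)
    qed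
    then have "(\<Sum>k\<in>cube (Suc n). of_bool (\<forall>s. if s \<in> A then k s = n else k s = 0) * \<alpha> k)
      = (\<Sum>k\<in>cube (Suc n). if k = (\<lambda>s. n * of_bool (s \<in> A)) then \<alpha> k else 0)"
      by (simp only:) (intro sum.cong refl, simp)
    moreover have "(\<lambda>s. n * of_bool (s \<in> A)) \<in> cube (Suc n)" by (simp add: cube_def)
    ultimately show ?thesis by simp
  qed
  have "(\<Sum>K\<in>UNIV. (-1) ^ card K * (\<Sum>k\<in>cube n. \<alpha> (\<lambda>s. k s + of_bool (s \<in> K))))
    = (\<Sum>k\<in>cube (Suc n). (\<Prod>s\<in>UNIV. of_bool (k s < n) - of_bool (1 \<le> k s)) * \<alpha> k)"
    unfolding L prod_of_bool_diff sum_distrib_left sum_distrib_right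
    by (subst sum.swap) (simp add: mult.assoc)
  also have "\<dots> = (\<Sum>k\<in>cube (Suc n). (\<Prod>s\<in>UNIV. of_bool (k s = 0) - of_bool (k s = n)) * \<alpha> k)"
  proof (intro sum.cong refl arg_cong2[of _ _ _ _ "(*)"] prod.cong)
    fix k :: "'d \<Rightarrow> nat" and s assume "k \<in> cube (Suc n)"
    then have "k s < Suc n" by (simp add: cube_def)
    then show "(of_bool (k s < n) - of_bool (1 \<le> k s) :: real) = of_bool (k s = 0) - of_bool (k s = n)"
      using assms by (cases "k s = 0"; cases "k s = n") auto
  qed
  also have "\<dots> = (\<Sum>A\<in>UNIV. (-1) ^ card A * \<alpha> (\<lambda>s. n * of_bool (s \<in> A)))"
    unfolding R prod_of_bool_diff sum_distrib_left sum_distrib_right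
    by (subst sum.swap) (simp add: mult.assoc)
  finally show ?thesis .
qed

subsection \<open>Minkowski's inequality and series in \<open>L\<^sup>p\<close>\<close>

lemma convex_on_abs_powr:
  fixes p :: real
  assumes p: "p \<ge> 1"
  shows "convex_on UNIV (\<lambda>x::real. \<bar>x\<bar> powr p)"
proof (rule convex_onI)
  fix t x y :: real
  assume t: "0 < t" "t < 1"
  \<comment> \<open>Convexity of the power is taken on the open half-line. When one of the two
    points is 0, this bound replaces it; it rests on c^p <= c for 0 < c < 1.\<close>
  have scale: "(c * z) powr p \<le> c * z powr p" if "0 < c" "c < 1" "0 \<le> z" for c z :: real
  proof -
    have "c powr p \<le> c powr 1" using that p by (intro powr_mono') auto
    then show ?thesis using that by (simp add: powr_mult mult_right_mono)
  qed
  have "\<bar>(1 - t) * x + t * y\<bar> powr p \<le> ((1 - t) * \<bar>x\<bar> + t * \<bar>y\<bar>) powr p"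
    using t p abs_triangle_ineq[of "(1 - t) * x" "t * y"]
    by (intro powr_mono2) (auto simp: abs_mult)
  also have "\<dots> \<le> (1 - t) * \<bar>x\<bar> powr p + t * \<bar>y\<bar> powr p"
  proof -
    consider "x = 0" | "y = 0" | "\<bar>x\<bar> \<in> {0<..}" "\<bar>y\<bar> \<in> {0<..}" by fastforce
    then show ?thesis
    proof cases
      case 1 then show ?thesis using scale[of t "\<bar>y\<bar>"] t p by simp
    next
      case 2 then show ?thesis using scale[of "1 - t" "\<bar>x\<bar>"] t p by simp
    next
      case 3
      then show ?thesis using convex_onD[OF powr_convex[OF p], of t "\<bar>x\<bar>" "\<bar>y\<bar>"] t by simp
    qed
  qed
  finally show "\<bar>(1 - t) *\<^sub>R x + t *\<^sub>R y\<bar> powr p \<le> (1 - t) * \<bar>x\<bar> powr p + t * \<bar>y\<bar> powr p"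
    by simp
qed simp

section \<open>The L^p norm, finite linear combinations and Minkowski's inequality\<close>

lemma Lp_norm_nonneg [simp]: "0 \<le> Lp_norm M p Z"
  by (simp add: Lp_norm_def)

lemma Lp_norm_powr:
  assumes "p \<ge> 1"
  shows "Lp_norm M p Z powr p = (\<integral>\<omega>. \<bar>Z \<omega>\<bar> powr p \<partial>M)"
  using assms by (simp add: Lp_norm_def powr_powr)

lemma Lp_norm_le_iff:
  assumes "p \<ge> 1" "w \<ge> 0"
  shows "Lp_norm M p Z \<le> w \<longleftrightarrow> (\<integral>\<omega>. \<bar>Z \<omega>\<bar> powr p \<partial>M) \<le> w powr p"
proof -
  have "Lp_norm M p Z \<le> w \<longleftrightarrow> Lp_norm M p Z powr p \<le> w powr p"
    using assms powr_mono2[of p "Lp_norm M p Z" w] powr_less_mono2[of p w "Lp_norm M p Z"]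
    by (force simp: not_le[symmetric])
  then show ?thesis by (simp add: Lp_norm_powr assms)
qed

lemma Lp_norm_1: "Lp_norm M 1 Z = (\<integral>\<omega>. \<bar>Z \<omega>\<bar> \<partial>M)"
  by (simp add: Lp_norm_def)

lemma Lp_space_subalgebra:
  "subalgebra N F \<Longrightarrow> Z \<in> Lp_space M F p \<Longrightarrow> Z \<in> Lp_space M N p"
  by (simp add: Lp_space_def measurable_from_subalg)

lemma Lp_space_scaled_add:
  assumes p: "p \<ge> 1" and "Y \<in> Lp_space M N p" "Z \<in> Lp_space M N p"
    and N: "subalgebra M N"
  shows "(\<lambda>\<omega>. c * Y \<omega> + Z \<omega>) \<in> Lp_space M N p"
proof -
  have m: "Y \<in> borel_measurable N" "Z \<in> borel_measurable N"
    "integrable M (\<lambda>\<omega>. \<bar>Y \<omega>\<bar> powr p)" "integrable M (\<lambda>\<omega>. \<bar>Z \<omega>\<bar> powr p)"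
    using assms by (auto simp: Lp_space_def)
  note [measurable] = measurable_from_subalg[OF N m(1)] measurable_from_subalg[OF N m(2)]
  have "integrable M (\<lambda>\<omega>. \<bar>c * Y \<omega> + Z \<omega>\<bar> powr p)"
  proof (rule Bochner_Integration.integrable_bound)
    show "integrable M (\<lambda>\<omega>. 2 powr p * (\<bar>c\<bar> powr p * \<bar>Y \<omega>\<bar> powr p + \<bar>Z \<omega>\<bar> powr p))"
      by (intro integrable_mult_right Bochner_Integration.integrable_add m)
    have "\<bar>a + b\<bar> powr p \<le> 2 powr p * (\<bar>a\<bar> powr p + \<bar>b\<bar> powr p)" for a b :: real
    proof -
      have "\<bar>a + b\<bar> powr p \<le> (2 * max \<bar>a\<bar> \<bar>b\<bar>) powr p" using p by (intro powr_mono2) auto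
      also have "\<dots> = 2 powr p * max \<bar>a\<bar> \<bar>b\<bar> powr p" by (subst powr_mult) auto
      also have "\<dots> \<le> 2 powr p * (\<bar>a\<bar> powr p + \<bar>b\<bar> powr p)" by (intro mult_left_mono) (auto simp: max_def)
      finally show ?thesis .
    qed
    from this[of "c * Y _" "Z _"]
    show "AE \<omega> in M. norm (\<bar>c * Y \<omega> + Z \<omega>\<bar> powr p)
      \<le> norm (2 powr p * (\<bar>c\<bar> powr p * \<bar>Y \<omega>\<bar> powr p + \<bar>Z \<omega>\<bar> powr p))"
      by (auto simp: abs_mult powr_mult)
  qed simp
  then show ?thesis using m by (simp add: Lp_space_def)
qed

lemma Lp_space_zero: "(\<lambda>_. 0) \<in> Lp_space M N p"
  by (simp add: Lp_space_def)

lemma Lp_space_sum: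
  assumes "p \<ge> 1" "subalgebra M N" and "\<And>k. k \<in> F \<Longrightarrow> Z k \<in> Lp_space M N p"
  shows "(\<lambda>\<omega>. \<Sum>k\<in>F. c k * Z k \<omega>) \<in> Lp_space M N p"
  using assms(3)
proof (induction F rule: infinite_finite_induct)
  case (insert x F)
  then show ?case
    using Lp_space_scaled_add[OF assms(1) _ _ assms(2), of "Z x" "\<lambda>\<omega>. \<Sum>k\<in>F. c k * Z k \<omega>" "c x"]
    by simp
qed (simp_all add: Lp_space_zero)

text \<open>By convexity of |x|^p: the sum divided by \<open>W\<close> is the average of the
  \<open>Z k / w k\<close> with weights \<open>w k / W\<close>, and each \<open>Z k / w k\<close>
  has norm at most 1.\<close>

lemma Lp_norm_sum_le:
  fixes Z :: "'k \<Rightarrow> 'a \<Rightarrow> real"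
  assumes p: "p \<ge> 1" and F: "finite F" and Z: "\<And>k. k \<in> F \<Longrightarrow> Z k \<in> Lp_space M M p"
  shows "Lp_norm M p (\<lambda>\<omega>. \<Sum>k\<in>F. Z k \<omega>) \<le> (\<Sum>k\<in>F. Lp_norm M p (Z k))"
proof (cases "F = {}")
  case False
  have approx: "Lp_norm M p (\<lambda>\<omega>. \<Sum>k\<in>F. Z k \<omega>) \<le> (\<Sum>k\<in>F. Lp_norm M p (Z k) + e)" if e: "e > 0" for e
  proof -
    \<comment> \<open>Adding \<open>e\<close> keeps the divisors positive even where
      \<open>Z k\<close> has norm 0. The total excess, \<open>card F\<close> times \<open>e\<close>,
      is made arbitrarily small at the end.\<close>
    define w where "w = (\<lambda>k. Lp_norm M p (Z k) + e)"
    define W where "W = (\<Sum>k\<in>F. w k)"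
    have w: "w k > 0" for k using e by (simp add: w_def add_nonneg_pos)
    have W: "W > 0" unfolding W_def using F False w by (intro sum_pos) auto
    have int: "integrable M (\<lambda>\<omega>. \<bar>Z k \<omega>\<bar> powr p)" if "k \<in> F" for k
      using Z[OF that] by (simp add: Lp_space_def)
    have pw: "\<bar>\<Sum>k\<in>F. Z k \<omega>\<bar> powr p \<le> (\<Sum>k\<in>F. W powr p * (w k / W) * (1 / w k) powr p * \<bar>Z k \<omega>\<bar> powr p)" for \<omega>
    proof -
      have "\<bar>\<Sum>k\<in>F. (w k / W) *\<^sub>R (Z k \<omega> / w k)\<bar> powr p \<le> (\<Sum>k\<in>F. (w k / W) * \<bar>Z k \<omega> / w k\<bar> powr p)"
        by (rule convex_on_sum[OF F False convex_on_abs_powr[OF p]])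
          (use W w in \<open>auto simp: less_imp_le W_def sum_divide_distrib[symmetric]\<close>)
      also have "(\<Sum>k\<in>F. (w k / W) *\<^sub>R (Z k \<omega> / w k)) = (\<Sum>k\<in>F. Z k \<omega>) / W"
        unfolding sum_divide_distrib using w by (intro sum.cong refl) (simp add: less_imp_neq[symmetric])
      finally have "W powr p * \<bar>(\<Sum>k\<in>F. Z k \<omega>) / W\<bar> powr p
        \<le> W powr p * (\<Sum>k\<in>F. (w k / W) * \<bar>Z k \<omega> / w k\<bar> powr p)" by (intro mult_left_mono) auto
      moreover have "W powr p * \<bar>(\<Sum>k\<in>F. Z k \<omega>) / W\<bar> powr p = \<bar>\<Sum>k\<in>F. Z k \<omega>\<bar> powr p"
        using W by (subst powr_mult[symmetric]) (auto simp: abs_divide)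
      moreover have "\<bar>Z k \<omega> / w k\<bar> powr p = (1 / w k) powr p * \<bar>Z k \<omega>\<bar> powr p" for k
        using w[of k] by (subst powr_mult[symmetric]) (auto simp: abs_divide)
      ultimately show ?thesis by (simp add: sum_distrib_left mult.assoc)
    qed
    have "(\<integral>\<omega>. \<bar>\<Sum>k\<in>F. Z k \<omega>\<bar> powr p \<partial>M)
      \<le> (\<integral>\<omega>. (\<Sum>k\<in>F. W powr p * (w k / W) * (1 / w k) powr p * \<bar>Z k \<omega>\<bar> powr p) \<partial>M)"
      by (rule integral_mono'[OF _ pw order_trans[OF powr_ge_zero pw]]) (use int in auto)
    also have "\<dots> = (\<Sum>k\<in>F. W powr p * (w k / W) * (1 / w k) powr p * Lp_norm M p (Z k) powr p)"
      using int by (simp add: Lp_norm_powr[OF p])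
    also have "\<dots> \<le> (\<Sum>k\<in>F. W powr p * (w k / W))"
    proof (rule sum_mono)
      fix k
      have "(1 / w k) powr p * Lp_norm M p (Z k) powr p = (Lp_norm M p (Z k) / w k) powr p"
        using w[of k] by (subst powr_mult[symmetric]) auto
      also have "\<dots> \<le> 1"
        using e w[of k] p by (intro powr_le1) (auto simp: w_def divide_simps)
      finally show "W powr p * (w k / W) * (1 / w k) powr p * Lp_norm M p (Z k) powr p \<le> W powr p * (w k / W)"
        using W w[of k] mult_left_mono[of "(1 / w k) powr p * Lp_norm M p (Z k) powr p" 1 "W powr p * (w k / W)"]
        by (simp add: mult.assoc)
    qed
    also have "\<dots> = W powr p"
      using W by (simp add: sum_distrib_left[symmetric] sum_divide_distrib[symmetric] W_def[symmetric])
    finally show ?thesis using W by (simp add: Lp_norm_le_iff[OF p] W_def w_def)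
  qed
  show ?thesis
  proof (rule field_le_epsilon)
    fix e :: real assume "e > 0"
    then show "Lp_norm M p (\<lambda>\<omega>. \<Sum>k\<in>F. Z k \<omega>) \<le> (\<Sum>k\<in>F. Lp_norm M p (Z k)) + e"
      using approx[of "e / card F"] False F by (simp add: sum.distrib card_gt_0_iff)
  qed
qed (use p in \<open>simp add: Lp_norm_def\<close>)

section \<open>Comparison with L^1 and absolutely convergent series on a probability space\<close>

context prob_space
begin

lemma Lp_space_integrable:
  assumes p: "p \<ge> 1" and Z: "Z \<in> Lp_space M M p"
  shows "integrable M Z"
proof (rule Bochner_Integration.integrable_bound)
  show "integrable M (\<lambda>\<omega>. 1 + \<bar>Z \<omega>\<bar> powr p)" "Z \<in> borel_measurable M"
    using Z by (auto simp: Lp_space_def)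
  have "\<bar>x\<bar> \<le> 1 + \<bar>x\<bar> powr p" for x :: real
    using powr_mono[of 1 p "\<bar>x\<bar>"] p by (cases "\<bar>x\<bar> \<ge> 1") (auto intro: add_increasing2)
  then show "AE \<omega> in M. norm (Z \<omega>) \<le> norm (1 + \<bar>Z \<omega>\<bar> powr p)"
    by simp
qed

text \<open>Jensen's inequality. It lets L^p bounds control limits taken in L^1.\<close>

lemma integral_abs_le_Lp_norm:
  assumes p: "p \<ge> 1" and Z: "Z \<in> Lp_space M M p"
  shows "(\<integral>\<omega>. \<bar>Z \<omega>\<bar> \<partial>M) \<le> Lp_norm M p Z"
proof -
  have "\<bar>\<integral>\<omega>. \<bar>Z \<omega>\<bar> \<partial>M\<bar> powr p \<le> (\<integral>\<omega>. \<bar>\<bar>Z \<omega>\<bar>\<bar> powr p \<partial>M)"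
    by (rule jensens_inequality[where I=UNIV])
      (use Lp_space_integrable[OF p Z] Z convex_on_abs_powr[OF p] in \<open>auto simp: Lp_space_def\<close>)
  then have "\<bar>\<integral>\<omega>. \<bar>Z \<omega>\<bar> \<partial>M\<bar> powr p \<le> Lp_norm M p Z powr p"
    by (simp add: Lp_norm_powr[OF p])
  then show ?thesis
    using powr_less_mono2[of p "Lp_norm M p Z" "\<integral>\<omega>. \<bar>Z \<omega>\<bar> \<partial>M"] p by force
qed

text \<open>By Minkowski the partial sums of the |Z i| are bounded in L^p, so their limit
  \<open>D\<close> lies in L^p by monotone convergence. \<open>D\<close> then dominates the series
  and its partial sums.\<close>

lemma Lp_series:
  fixes Z :: "nat \<Rightarrow> 'a \<Rightarrow> real"
  assumes p: "p \<ge> 1" and Z: "\<And>i. Z i \<in> Lp_space M M p" and sm: "summable (\<lambda>i. Lp_norm M p (Z i))"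
  shows "(\<lambda>\<omega>. \<Sum>i. Z i \<omega>) \<in> Lp_space M M p"
    and "(\<lambda>n. \<integral>\<omega>. \<bar>(\<Sum>i. Z i \<omega>) - (\<Sum>i<n. Z i \<omega>)\<bar> \<partial>M) \<longlonglongrightarrow> 0"
proof -
  have [measurable]: "Z i \<in> borel_measurable M" for i using Z by (simp add: Lp_space_def)
  have int: "integrable M (Z i)" for i by (rule Lp_space_integrable[OF p Z])
  define D where "D = (\<lambda>\<omega>. \<Sum>i. \<bar>Z i \<omega>\<bar>)"
  have D_meas [measurable]: "D \<in> borel_measurable M" unfolding D_def by measurable
  \<comment> \<open>Finite total L^1 norm forces absolute convergence almost surely. Elsewhere a
    real infinite sum has an unspecified value, so facts about \<open>D\<close> are claimed only
    almost everywhere.\<close>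
  have "(\<integral>\<^sup>+\<omega>. (\<Sum>i. ennreal \<bar>Z i \<omega>\<bar>) \<partial>M) = (\<Sum>i. \<integral>\<^sup>+\<omega>. ennreal \<bar>Z i \<omega>\<bar> \<partial>M)"
    by (rule nn_integral_suminf) simp
  also have "\<dots> = (\<Sum>i. ennreal (\<integral>\<omega>. \<bar>Z i \<omega>\<bar> \<partial>M))"
    using int by (simp add: nn_integral_eq_integral)
  also have "\<dots> \<le> (\<Sum>i. ennreal (Lp_norm M p (Z i)))"
    by (intro suminf_le) (auto intro!: ennreal_leI integral_abs_le_Lp_norm[OF p Z])
  also have "\<dots> < \<infinity>"
    using sm by (simp add: suminf_ennreal2 less_top)
  finally have "AE \<omega> in M. (\<Sum>i. ennreal \<bar>Z i \<omega>\<bar>) \<noteq> \<infinity>"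
    by (intro nn_integral_PInf_AE) auto
  then have summ: "AE \<omega> in M. summable (\<lambda>i. \<bar>Z i \<omega>\<bar>)"
    by eventually_elim (auto intro: summable_suminf_not_top)
  have abs_Lp: "(\<lambda>\<omega>. \<bar>Z i \<omega>\<bar>) \<in> Lp_space M M p" for i using Z by (simp add: Lp_space_def)
  have partial: "(\<integral>\<omega>. (\<Sum>i<n. \<bar>Z i \<omega>\<bar>) powr p \<partial>M) \<le> (\<Sum>i. Lp_norm M p (Z i)) powr p" for n
  proof -
    have "Lp_norm M p (\<lambda>\<omega>. \<Sum>i<n. \<bar>Z i \<omega>\<bar>) \<le> (\<Sum>i<n. Lp_norm M p (Z i))"
      using Lp_norm_sum_le[OF p, of "{..<n}" "\<lambda>i \<omega>. \<bar>Z i \<omega>\<bar>"] abs_Lp by (simp add: Lp_norm_def)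
    also have "\<dots> \<le> (\<Sum>i. Lp_norm M p (Z i))" by (rule sum_le_suminf[OF sm]) auto
    finally show ?thesis
      by (subst (asm) Lp_norm_le_iff[OF p]) (auto intro: suminf_nonneg[OF sm])
  qed
  have pint: "integrable M (\<lambda>\<omega>. (\<Sum>i<n. \<bar>Z i \<omega>\<bar>) powr p)" for n
    using Lp_space_sum[OF p, of M M "{..<n}" "\<lambda>i \<omega>. \<bar>Z i \<omega>\<bar>" "\<lambda>_. 1"] abs_Lp
    by (simp add: Lp_space_def subalgebra_def abs_of_nonneg sum_nonneg)
  have mono: "mono (\<lambda>n. (\<Sum>i<n. \<bar>Z i \<omega>\<bar>) powr p)" for \<omega>
    using p by (intro monoI powr_mono2 sum_mono2) (auto intro: sum_nonneg)
  \<comment> \<open>The integrals increase and are bounded by \<open>partial\<close>, so they have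
    the limit that monotone convergence asks for.\<close>
  have "incseq (\<lambda>n. \<integral>\<omega>. (\<Sum>i<n. \<bar>Z i \<omega>\<bar>) powr p \<partial>M)"
    by (intro incseq_SucI integral_mono pint) (use mono in \<open>auto simp: incseq_Suc_iff\<close>)
  then obtain L where L: "(\<lambda>n. \<integral>\<omega>. (\<Sum>i<n. \<bar>Z i \<omega>\<bar>) powr p \<partial>M) \<longlonglongrightarrow> L"
    using partial by (elim incseq_convergent) auto
  have Dp: "integrable M (\<lambda>\<omega>. D \<omega> powr p)"
  proof (rule integrable_monotone_convergence[OF pint _ _ L])
    show "AE \<omega> in M. (\<lambda>n. (\<Sum>i<n. \<bar>Z i \<omega>\<bar>) powr p) \<longlonglongrightarrow> D \<omega> powr p"
      using summ
    proof eventually_elim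
      case (elim \<omega>)
      show ?case unfolding D_def
        using summable_LIMSEQ[OF elim] p by (intro tendsto_powr2) (auto intro: sum_nonneg)
    qed
  qed (use mono in auto)
  have "D \<in> Lp_space M M p"
  proof -
    \<comment> \<open>The sign of \<open>D\<close> is known only where its series converges.\<close>
    have "AE \<omega> in M. \<bar>D \<omega>\<bar> powr p = D \<omega> powr p"
      using summ by eventually_elim (simp add: D_def suminf_nonneg)
    then have "integrable M (\<lambda>\<omega>. \<bar>D \<omega>\<bar> powr p)"
      using Dp integrable_cong_AE[of "\<lambda>\<omega>. \<bar>D \<omega>\<bar> powr p" M "\<lambda>\<omega>. D \<omega> powr p"] by simp
    then show ?thesis by (simp add: Lp_space_def)
  qed
  then have Dint: "integrable M D" by (rule Lp_space_integrable[OF p])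
  show "(\<lambda>\<omega>. \<Sum>i. Z i \<omega>) \<in> Lp_space M M p"
    unfolding Lp_space_def
  proof (intro CollectI conjI)
    show "integrable M (\<lambda>\<omega>. \<bar>\<Sum>i. Z i \<omega>\<bar> powr p)"
    proof (rule Bochner_Integration.integrable_bound[OF Dp])
      show "AE \<omega> in M. norm (\<bar>\<Sum>i. Z i \<omega>\<bar> powr p) \<le> norm (D \<omega> powr p)"
        using summ by eventually_elim (use p in \<open>auto simp: D_def intro!: powr_mono2 summable_rabs\<close>)
    qed simp
  qed simp
  have "(\<lambda>n. \<integral>\<omega>. \<bar>(\<Sum>i. Z i \<omega>) - (\<Sum>i<n. Z i \<omega>)\<bar> \<partial>M) \<longlonglongrightarrow> (\<integral>\<omega>. 0 \<partial>M)"
  proof (rule integral_dominated_convergence[where w="\<lambda>\<omega>. 2 * D \<omega>"])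
    show "AE \<omega> in M. (\<lambda>n. \<bar>(\<Sum>i. Z i \<omega>) - (\<Sum>i<n. Z i \<omega>)\<bar>) \<longlonglongrightarrow> 0"
      using summ
    proof eventually_elim
      case (elim \<omega>)
      show ?case
        using tendsto_diff[OF tendsto_const summable_LIMSEQ[OF summable_rabs_cancel[OF elim]], of "\<Sum>i. Z i \<omega>"]
        by (intro tendsto_rabs_zero) simp
    qed
    show "AE \<omega> in M. norm \<bar>(\<Sum>i. Z i \<omega>) - (\<Sum>i<n. Z i \<omega>)\<bar> \<le> 2 * D \<omega>" for n
      using summ
    proof eventually_elim
      case (elim \<omega>)
      have "\<bar>\<Sum>i<n. Z i \<omega>\<bar> \<le> (\<Sum>i<n. \<bar>Z i \<omega>\<bar>)" by (rule sum_abs)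
      also have "\<dots> \<le> D \<omega>" unfolding D_def by (rule sum_le_suminf[OF elim]) auto
      finally have "\<bar>\<Sum>i<n. Z i \<omega>\<bar> \<le> D \<omega>" .
      moreover have "\<bar>\<Sum>i. Z i \<omega>\<bar> \<le> D \<omega>" unfolding D_def by (rule summable_rabs[OF elim])
      ultimately show ?case by simp
    qed
  qed (use Dint in simp_all)
  then show "(\<lambda>n. \<integral>\<omega>. \<bar>(\<Sum>i. Z i \<omega>) - (\<Sum>i<n. Z i \<omega>)\<bar> \<partial>M) \<longlonglongrightarrow> 0" by simp
qed

end

subsection \<open>Conditional expectations along the filtration\<close>

text \<open>Conditional Jensen for |x|^p. Integrating it gives the norm bound, because conditioning
  preserves the integral.\<close>

lemma real_cond_exp_Lp:
  assumes "prob_space M" "subalgebra M F" and p: "p \<ge> 1" and Z: "Z \<in> Lp_space M M p"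
  shows "real_cond_exp M F Z \<in> Lp_space M F p"
    and "Lp_norm M p (real_cond_exp M F Z) \<le> Lp_norm M p Z"
proof -
  interpret prob_space M by fact
  interpret finite_measure_subalgebra M F by unfold_locales fact
  have int: "integrable M Z" "integrable M (\<lambda>\<omega>. \<bar>Z \<omega>\<bar> powr p)"
    using Z Lp_space_integrable[OF p Z] by (auto simp: Lp_space_def)
  have eint: "integrable M (\<lambda>\<omega>. \<bar>real_cond_exp M F Z \<omega>\<bar> powr p)"
    by (rule integrable_convex_cond_exp[where I = UNIV and q = "\<lambda>x. \<bar>x\<bar> powr p"])
      (use int convex_on_abs_powr[OF p] in auto)
  then show "real_cond_exp M F Z \<in> Lp_space M F p" by (simp add: Lp_space_def)
  have "AE \<omega> in M. \<bar>real_cond_exp M F Z \<omega>\<bar> powr p \<le> real_cond_exp M F (\<lambda>\<omega>. \<bar>Z \<omega>\<bar> powr p) \<omega>"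
    by (rule real_cond_exp_jensens_inequality(2)[where I = UNIV and q = "\<lambda>x. \<bar>x\<bar> powr p"])
      (use int convex_on_abs_powr[OF p] in auto)
  then have "(\<integral>\<omega>. \<bar>real_cond_exp M F Z \<omega>\<bar> powr p \<partial>M)
      \<le> (\<integral>\<omega>. real_cond_exp M F (\<lambda>\<omega>. \<bar>Z \<omega>\<bar> powr p) \<omega> \<partial>M)"
    by (intro integral_mono_AE eint real_cond_exp_int int)
  also have "\<dots> = (\<integral>\<omega>. \<bar>Z \<omega>\<bar> powr p \<partial>M)" by (rule real_cond_exp_int(2)[OF int(2)])
  finally show "Lp_norm M p (real_cond_exp M F Z) \<le> Lp_norm M p Z"
    unfolding Lp_norm_def using p by (intro powr_mono2) auto
qed

lemma integral_abs_real_cond_exp_le: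
  assumes "prob_space M" "subalgebra M F" and Z: "integrable M Z"
  shows "(\<integral>\<omega>. \<bar>real_cond_exp M F Z \<omega>\<bar> \<partial>M) \<le> (\<integral>\<omega>. \<bar>Z \<omega>\<bar> \<partial>M)"
  using real_cond_exp_Lp(2)[OF assms(1,2), of 1 Z] Z by (simp add: Lp_norm_1 Lp_space_def)

lemma Lp_norm_cong_AE:
  assumes "AE \<omega> in M. Y \<omega> = Z \<omega>" "Y \<in> borel_measurable M" "Z \<in> borel_measurable M"
  shows "Lp_norm M p Y = Lp_norm M p Z"
  unfolding Lp_norm_def
  by (rule arg_cong2[where f="(powr)", OF integral_cong_AE refl]) (use assms in auto)

section \<open>Lattice vectors and the filtration generated by the action\<close>

definition ind_vec :: "'d::finite set \<Rightarrow> int ^ 'd" where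
  "ind_vec K = (\<chi> s. of_bool (s \<in> K))"

definition int_vec :: "('d::finite \<Rightarrow> nat) \<Rightarrow> int ^ 'd" where
  "int_vec k = (\<chi> s. int (k s))"

lemma ind_vec_empty [simp]: "ind_vec {} = 0"
  by (simp add: ind_vec_def vec_eq_iff)

lemma ind_vec_insert: "s \<notin> K \<Longrightarrow> ind_vec (insert s K) = ind_vec K + axis s 1"
  by (auto simp: ind_vec_def axis_def vec_eq_iff)

lemma ind_vec_nonneg: "0 \<le> ind_vec K"
  by (simp add: ind_vec_def less_eq_vec_def)

locale stationary_filtration = prob_space M for M :: "'a measure" +
  fixes N :: "'a measure" and T :: "int ^ 'd::finite \<Rightarrow> 'a \<Rightarrow> 'a"
  assumes subalgebra_N: "subalgebra M N"
    and action: "measure_preserving_action M T"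
    and commuting: "commuting_filtration M UNIV (\<lambda>i. shift_alg M T N (- i))"
begin

text \<open>\<open>shift_alg\<close> at \<open>- i\<close> is T^(-i) \<open>N\<close>, whose members
  are preimages under \<open>T i\<close>. In particular \<open>G\<close> at -n e_s is T_s^n
  \<open>N\<close>.\<close>

definition G :: "int ^ 'd \<Rightarrow> 'a measure" where
  "G i = shift_alg M T N (- i)"

abbreviation E :: "int ^ 'd \<Rightarrow> ('a \<Rightarrow> real) \<Rightarrow> 'a \<Rightarrow> real" where
  "E i \<equiv> real_cond_exp M (G i)"

lemma T_measurable [measurable]: "T i \<in> measurable M M"
  using action by (simp add: measure_preserving_action_def)

lemma T_space: "\<omega> \<in> space M \<Longrightarrow> T i \<omega> \<in> space M"
  by (rule measurable_space[OF T_measurable])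

lemma T_add: "\<omega> \<in> space M \<Longrightarrow> T i (T j \<omega>) = T (i + j) \<omega>"
  using action by (simp add: measure_preserving_action_def)

lemma T_zero: "\<omega> \<in> space M \<Longrightarrow> T 0 \<omega> = \<omega>"
  using action by (simp add: measure_preserving_action_def)

lemma distr_T: "distr M M (T i) = M"
  using action by (simp add: measure_preserving_action_def)

lemma integral_comp_T:
  fixes Z :: "'a \<Rightarrow> real"
  shows "Z \<in> borel_measurable M \<Longrightarrow> (\<integral>\<omega>. Z (T i \<omega>) \<partial>M) = (\<integral>\<omega>. Z \<omega> \<partial>M)"
  using integral_distr[OF T_measurable, of Z i] by (simp add: distr_T)

lemma integrable_comp_T:
  fixes Z :: "'a \<Rightarrow> real"
  shows "integrable M Z \<Longrightarrow> integrable M (\<lambda>\<omega>. Z (T i \<omega>))"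
  by (rule integrable_distr[OF T_measurable]) (simp add: distr_T)

lemma Lp_comp_T:
  assumes "Z \<in> Lp_space M M p"
  shows "(\<lambda>\<omega>. Z (T i \<omega>)) \<in> Lp_space M M p"
    and "Lp_norm M p (\<lambda>\<omega>. Z (T i \<omega>)) = Lp_norm M p Z"
  using assms integrable_comp_T[of "\<lambda>\<omega>. \<bar>Z \<omega>\<bar> powr p" i] integral_comp_T[of "\<lambda>\<omega>. \<bar>Z \<omega>\<bar> powr p" i]
  by (auto simp: Lp_space_def Lp_norm_def)

lemma space_G [simp]: "space (G i) = space M"
  by (simp add: G_def shift_alg_def)

lemma space_N: "space N = space M"
  using subalgebra_N by (simp add: subalgebra_def)

lemma sets_G: "sets (G i) = {T i -` A \<inter> space M | A. A \<in> sets N}"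
  unfolding G_def shift_alg_def
  by (subst sets_vimage_algebra2) (auto simp: space_N T_space)

lemma sets_G_0: "sets (G 0) = sets N"
proof -
  have "T 0 -` A \<inter> space M = A" if "A \<in> sets N" for A
    using sets.sets_into_space[OF that] by (auto simp: space_N T_zero)
  then have "(\<lambda>A. T 0 -` A \<inter> space M) ` sets N = sets N" by simp
  moreover have "sets (G 0) = (\<lambda>A. T 0 -` A \<inter> space M) ` sets N" by (auto simp: sets_G)
  ultimately show ?thesis by simp
qed

lemma subalgebra_G: "subalgebra M (G i)"
  using commuting by (simp add: commuting_filtration_def lattice_on_def G_def)

lemma subalgebra_G_mono: "i \<le> j \<Longrightarrow> subalgebra (G j) (G i)"
  using commuting by (simp add: commuting_filtration_def lattice_on_def G_def[symmetric] subalgebra_def)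

lemma sigma_finite_G: "sigma_finite_subalgebra M (G i)"
proof -
  interpret finite_measure_subalgebra M "G i" by unfold_locales (rule subalgebra_G)
  show ?thesis by unfold_locales
qed

lemma T_measurable_G: "T k \<in> measurable (G (j + k)) (G j)"
proof (rule measurableI)
  fix A assume "A \<in> sets (G j)"
  then obtain A0 where "A0 \<in> sets N" "A = T j -` A0 \<inter> space M" by (auto simp: sets_G)
  then show "T k -` A \<inter> space (G (j + k)) \<in> sets (G (j + k))"
    by (auto simp: sets_G T_add T_space intro!: exI[of _ A0])
qed (simp add: T_space)

text \<open>Complements \<open>T_measurable_G\<close>: together they identify
  \<open>G (j + k)\<close> as the pullback of \<open>G j\<close>, so test sets for conditional
  expectations can be moved along \<open>T k\<close>.\<close>

lemma sets_G_add:
  assumes "A \<in> sets (G (j + k))"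
  obtains A' where "A' \<in> sets (G j)" "A = T k -` A' \<inter> space M"
proof -
  obtain A0 where "A0 \<in> sets N" "A = T (j + k) -` A0 \<inter> space M" using assms by (auto simp: sets_G)
  then show thesis by (intro that[of "T j -` A0 \<inter> space M"]) (auto simp: sets_G T_add T_space)
qed

text \<open>Covariance E(j + k) U^k = U^k E(j): a test set in \<open>G (j + k)\<close> is the
  preimage of one in \<open>G j\<close>, and measure preservation moves both integrals onto the
  latter.\<close>

lemma E_comp_T:
  assumes Z: "integrable M Z"
  shows "AE \<omega> in M. E (j + k) (\<lambda>\<omega>. Z (T k \<omega>)) \<omega> = E j Z (T k \<omega>)"
proof (rule sigma_finite_subalgebra.real_cond_exp_charact[OF sigma_finite_G])
  note [measurable] = borel_measurable_integrable[OF Z]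
  fix A assume "A \<in> sets (G (j + k))"
  then obtain A' where A': "A' \<in> sets (G j)" and A: "A = T k -` A' \<inter> space M" by (rule sets_G_add)
  have [measurable]: "A' \<in> sets M" using A' subalgebra_G by (auto simp: subalgebra_def)
  have pull: "(\<integral>\<omega>\<in>A. Y (T k \<omega>) \<partial>M) = (\<integral>\<omega>\<in>A'. Y \<omega> \<partial>M)"
    if [measurable]: "Y \<in> borel_measurable M" for Y :: "'a \<Rightarrow> real"
  proof -
    have "(\<integral>\<omega>\<in>A. Y (T k \<omega>) \<partial>M) = (\<integral>\<omega>. indicator A' (T k \<omega>) * Y (T k \<omega>) \<partial>M)"
      unfolding set_lebesgue_integral_def
      by (rule Bochner_Integration.integral_cong) (auto simp: A indicator_def)
    also have "\<dots> = (\<integral>\<omega>. indicator A' \<omega> * Y \<omega> \<partial>M)"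
      by (rule integral_comp_T[of "\<lambda>\<omega>. indicator A' \<omega> * Y \<omega>"]) measurable
    finally show ?thesis by (simp add: set_lebesgue_integral_def)
  qed
  show "(\<integral>\<omega>\<in>A. Z (T k \<omega>) \<partial>M) = (\<integral>\<omega>\<in>A. E j Z (T k \<omega>) \<partial>M)"
    using sigma_finite_subalgebra.real_cond_exp_intA[OF sigma_finite_G Z A']
    by (simp add: pull)
next
  show "integrable M (\<lambda>\<omega>. Z (T k \<omega>))" by (rule integrable_comp_T[OF Z])
  show "integrable M (\<lambda>\<omega>. E j Z (T k \<omega>))"
    by (rule integrable_comp_T[OF sigma_finite_subalgebra.real_cond_exp_int(1)[OF sigma_finite_G Z]])
  show "(\<lambda>\<omega>. E j Z (T k \<omega>)) \<in> borel_measurable (G (j + k))"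
    by (rule measurable_compose[OF T_measurable_G]) simp
qed

lemma E_integrable: "integrable M Z \<Longrightarrow> integrable M (E i Z)"
  by (rule sigma_finite_subalgebra.real_cond_exp_int(1)[OF sigma_finite_G])

lemma E_cong_space:
  assumes "\<And>\<omega>. \<omega> \<in> space M \<Longrightarrow> Y \<omega> = Z \<omega>" "Y \<in> borel_measurable M"
  shows "AE \<omega> in M. E i Y \<omega> = E i Z \<omega>"
  by (rule sigma_finite_subalgebra.real_cond_exp_cong[OF sigma_finite_G])
    (use assms measurable_cong[of M Y Z borel] in auto)

lemma E_tower:
  assumes "i \<le> j" "integrable M Z"
  shows "AE \<omega> in M. E i (E j Z) \<omega> = E i Z \<omega>"
  by (rule sigma_finite_subalgebra.real_cond_exp_nested_subalg[OF sigma_finite_G subalgebra_G])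
    (use assms subalgebra_G_mono in auto)

lemma E_L1_contraction:
  assumes "integrable M Y" "integrable M Z"
  shows "(\<integral>\<omega>. \<bar>E i Y \<omega> - E i Z \<omega>\<bar> \<partial>M) \<le> (\<integral>\<omega>. \<bar>Y \<omega> - Z \<omega>\<bar> \<partial>M)"
proof -
  have "(\<integral>\<omega>. \<bar>E i Y \<omega> - E i Z \<omega>\<bar> \<partial>M) = (\<integral>\<omega>. \<bar>E i (\<lambda>\<omega>. Y \<omega> - Z \<omega>) \<omega>\<bar> \<partial>M)"
    using sigma_finite_subalgebra.real_cond_exp_diff[OF sigma_finite_G assms, of i]
    by (intro integral_cong_AE) auto
  also have "\<dots> \<le> (\<integral>\<omega>. \<bar>Y \<omega> - Z \<omega>\<bar> \<partial>M)"
    using assms by (intro integral_abs_real_cond_exp_le subalgebra_G prob_space_axioms) auto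
  finally show ?thesis .
qed

text \<open>Turns L^1 approximation into almost sure equality. It is used for truncations and for
  partial sums over cubes, where \<open>n > 0\<close> excludes the empty cube.\<close>

lemma AE_eq_of_integral_abs_diff_le:
  fixes Y Z :: "'a \<Rightarrow> real"
  assumes "integrable M Y" "integrable M Z"
    and "\<And>n. n > 0 \<Longrightarrow> (\<integral>\<omega>. \<bar>Y \<omega> - Z \<omega>\<bar> \<partial>M) \<le> e n" and "e \<longlonglongrightarrow> 0"
  shows "AE \<omega> in M. Y \<omega> = Z \<omega>"
proof -
  have "(\<integral>\<omega>. \<bar>Y \<omega> - Z \<omega>\<bar> \<partial>M) \<le> 0"
    by (rule LIMSEQ_le_const[OF assms(4)]) (use assms(3) in \<open>auto intro!: exI[of _ 1]\<close>)
  then have "(\<integral>\<omega>. \<bar>Y \<omega> - Z \<omega>\<bar> \<partial>M) = 0"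
    by (intro antisym) auto
  then have "AE \<omega> in M. \<bar>Y \<omega> - Z \<omega>\<bar> = 0"
    by (subst (asm) integral_nonneg_eq_0_iff_AE) (use assms in auto)
  then show ?thesis by eventually_elim simp
qed

text \<open>The definition of a commuting filtration only speaks about bounded functions.\<close>

lemma E_commute:
  assumes Z: "integrable M Z"
  shows "AE \<omega> in M. E t (E s Z) \<omega> = E (vmin s t) Z \<omega>"
proof (rule AE_eq_of_integral_abs_diff_le)
  note [measurable] = borel_measurable_integrable[OF Z]
  show "integrable M (E t (E s Z))" "integrable M (E (vmin s t) Z)"
    by (intro E_integrable Z)+
  \<comment> \<open>Truncation at level \<open>n\<close>: bounded, so the definition applies, and
    dominated by \<open>Z\<close>, so it converges to \<open>Z\<close> in L^1.\<close>
  define Y where "Y = (\<lambda>n \<omega>. max (- real n) (min (real n) (Z \<omega>)))"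
  have Y_meas [measurable]: "Y n \<in> borel_measurable M" for n unfolding Y_def by measurable
  have Y_le: "\<bar>Y n \<omega>\<bar> \<le> \<bar>Z \<omega>\<bar>" for n \<omega> by (auto simp: Y_def)
  have Y_int: "integrable M (Y n)" for n
    by (rule Bochner_Integration.integrable_bound[OF Z]) (use Y_le in auto)
  have comm: "AE \<omega> in M. E t (E s (Y n)) \<omega> = E (vmin s t) (Y n) \<omega>" for n
  proof -
    have "\<exists>B. \<forall>\<omega>\<in>space M. \<bar>Y n \<omega>\<bar> \<le> B" by (intro exI[of _ "real n"]) (auto simp: Y_def)
    then show ?thesis
      using commuting by (simp add: commuting_filtration_def lattice_on_def G_def)
  qed
  \<comment> \<open>Both sides are compared with the identity for \<open>Y n\<close>; contraction
    bounds each of the two errors, whence the factor 2.\<close>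
  show "(\<integral>\<omega>. \<bar>E t (E s Z) \<omega> - E (vmin s t) Z \<omega>\<bar> \<partial>M) \<le> 2 * (\<integral>\<omega>. \<bar>Z \<omega> - Y n \<omega>\<bar> \<partial>M)" for n
  proof -
    have "(\<integral>\<omega>. \<bar>E t (E s Z) \<omega> - E (vmin s t) Z \<omega>\<bar> \<partial>M)
      \<le> (\<integral>\<omega>. \<bar>E t (E s Z) \<omega> - E t (E s (Y n)) \<omega>\<bar> + \<bar>E (vmin s t) Z \<omega> - E (vmin s t) (Y n) \<omega>\<bar> \<partial>M)"
    proof (rule integral_mono_AE)
      show "AE \<omega> in M. \<bar>E t (E s Z) \<omega> - E (vmin s t) Z \<omega>\<bar>
        \<le> \<bar>E t (E s Z) \<omega> - E t (E s (Y n)) \<omega>\<bar> + \<bar>E (vmin s t) Z \<omega> - E (vmin s t) (Y n) \<omega>\<bar>"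
        using comm[of n] by eventually_elim auto
    qed (intro Bochner_Integration.integrable_add integrable_abs Bochner_Integration.integrable_diff
        E_integrable Z Y_int)+
    also have "\<dots> = (\<integral>\<omega>. \<bar>E t (E s Z) \<omega> - E t (E s (Y n)) \<omega>\<bar> \<partial>M)
        + (\<integral>\<omega>. \<bar>E (vmin s t) Z \<omega> - E (vmin s t) (Y n) \<omega>\<bar> \<partial>M)"
      by (rule Bochner_Integration.integral_add) (auto intro!: E_integrable Z Y_int)
    also have "(\<integral>\<omega>. \<bar>E t (E s Z) \<omega> - E t (E s (Y n)) \<omega>\<bar> \<partial>M) \<le> (\<integral>\<omega>. \<bar>E s Z \<omega> - E s (Y n) \<omega>\<bar> \<partial>M)"
      by (intro E_L1_contraction E_integrable Z Y_int)
    also have "\<dots> \<le> (\<integral>\<omega>. \<bar>Z \<omega> - Y n \<omega>\<bar> \<partial>M)" by (intro E_L1_contraction Z Y_int)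
    also have "(\<integral>\<omega>. \<bar>E (vmin s t) Z \<omega> - E (vmin s t) (Y n) \<omega>\<bar> \<partial>M) \<le> (\<integral>\<omega>. \<bar>Z \<omega> - Y n \<omega>\<bar> \<partial>M)"
      by (intro E_L1_contraction Z Y_int)
    finally show ?thesis by simp
  qed
  have "(\<lambda>n. \<integral>\<omega>. \<bar>Z \<omega> - Y n \<omega>\<bar> \<partial>M) \<longlonglongrightarrow> (\<integral>\<omega>. 0 \<partial>M)"
  proof (rule integral_dominated_convergence[where w="\<lambda>\<omega>. 2 * \<bar>Z \<omega>\<bar>"])
    show "AE \<omega> in M. (\<lambda>n. \<bar>Z \<omega> - Y n \<omega>\<bar>) \<longlonglongrightarrow> 0"
    proof (rule AE_I2)
      fix \<omega>
      have "eventually (\<lambda>n. \<bar>Z \<omega> - Y n \<omega>\<bar> = 0) sequentially"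
        using eventually_ge_at_top[of "nat \<lceil>\<bar>Z \<omega>\<bar>\<rceil>"]
        by eventually_elim (auto simp: Y_def nat_ceiling_le_eq)
      then show "(\<lambda>n. \<bar>Z \<omega> - Y n \<omega>\<bar>) \<longlonglongrightarrow> 0" by (rule tendsto_eventually)
    qed
    show "AE \<omega> in M. norm \<bar>Z \<omega> - Y n \<omega>\<bar> \<le> 2 * \<bar>Z \<omega>\<bar>" for n
      by (rule AE_I2) (use Y_le[of n] in \<open>smt (verit) real_norm_def\<close>)
  qed (use Z in auto)
  then show "(\<lambda>n. 2 * (\<integral>\<omega>. \<bar>Z \<omega> - Y n \<omega>\<bar> \<partial>M)) \<longlonglongrightarrow> 0"
    using tendsto_mult_right_zero by simp
qed

end

subsection \<open>The components of the decomposition\<close>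

context stationary_filtration
begin

text \<open>Induction on \<open>J\<close>: a new factor I - U_s either leaves \<open>K\<close> alone
  or adds \<open>s\<close> to it and flips the sign.\<close>

lemma prod_I_minus_U_eq:
  assumes "\<omega> \<in> space M"
  shows "prod_I_minus_U M T J g \<omega> = (\<Sum>K\<in>Pow J. (-1) ^ card K * g (T (ind_vec K) \<omega>))"
proof -
  interpret comp_fun_commute "I_minus_U M T" by (rule comp_fun_commute_I_minus_U[OF action])
  have "finite J" by simp
  then show ?thesis using assms
  proof (induction J arbitrary: \<omega> rule: finite_induct)
    case empty
    then show ?case by (simp add: prod_I_minus_U_def T_zero)
  next
    case (insert s J)
    \<comment> \<open>The fold applies the new factor last, so the induction hypothesis is needed
      both at \<open>\<omega>\<close> and at its image under T_s; hence the generalisation over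
      \<open>\<omega>\<close>.\<close>
    have "prod_I_minus_U M T (insert s J) g \<omega>
        = prod_I_minus_U M T J g \<omega> - prod_I_minus_U M T J g (T (axis s 1) \<omega>)"
      using insert by (simp add: prod_I_minus_U_def I_minus_U_def U_op_def)
    also have "\<dots> = (\<Sum>K\<in>Pow J. (-1) ^ card K * g (T (ind_vec K) \<omega>)
        + (-1) ^ card (insert s K) * g (T (ind_vec (insert s K)) \<omega>))"
      unfolding insert.IH[OF insert.prems] insert.IH[OF T_space[OF insert.prems]] sum_subtractf[symmetric]
    proof (rule sum.cong[OF refl])
      fix K assume "K \<in> Pow J"
      then have "s \<notin> K" "finite K" using insert.hyps by (auto intro: finite_subset)
      then show "(-1) ^ card K * g (T (ind_vec K) \<omega>)
          - (-1) ^ card K * g (T (ind_vec K) (T (axis s 1) \<omega>))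
        = (-1) ^ card K * g (T (ind_vec K) \<omega>)
          + (-1) ^ card (insert s K) * g (T (ind_vec (insert s K)) \<omega>)"
        using insert.prems by (simp add: T_add ind_vec_insert)
    qed
    also have "\<dots> = (\<Sum>K\<in>Pow (insert s J). (-1) ^ card K * g (T (ind_vec K) \<omega>))"
      using insert.hyps by (subst sum_Pow_insert) auto
    finally show ?case .
  qed
qed

lemma U_on_eq:
  assumes "\<omega> \<in> space M"
  shows "U_on M T K i h \<omega> = h (T (\<chi> s. if s \<in> K then i $ s else 0) \<omega>)"
proof -
  interpret comp_fun_commute "\<lambda>s. U_op M T (axis s (i $ s))" by (rule comp_fun_commute_U_op[OF action])
  have "finite K" by simp
  then show ?thesis using assms
  proof (induction K arbitrary: \<omega> rule: finite_induct)
    case empty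
    then show ?case by (simp add: U_on_def T_zero zero_vec_def[symmetric])
  next
    case (insert s K)
    have "(\<chi> t. if t \<in> K then i $ t else 0) + axis s (i $ s) = (\<chi> t. if t \<in> insert s K then i $ t else 0)"
      using insert.hyps by (auto simp: vec_eq_iff axis_def)
    moreover have "U_on M T (insert s K) i h \<omega> = U_on M T K i h (T (axis s (i $ s)) \<omega>)"
      using insert by (simp add: U_on_def U_op_def)
    ultimately show ?case
      using insert.IH[OF T_space[OF insert.prems]] insert.prems by (simp add: T_add)
  qed
qed

lemma U_on_lattice_eq:
  assumes "\<omega> \<in> space M" "i \<in> lattice_on K"
  shows "U_on M T K i h \<omega> = h (T i \<omega>)"
proof -
  have "(\<chi> s. if s \<in> K then i $ s else 0) = i" using assms(2) by (auto simp: vec_eq_iff lattice_on_def)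
  then show ?thesis using U_on_eq[OF assms(1), of K i h] by simp
qed

text \<open>All conditions quantify over indices, so the one filtration on the full lattice can be
  restricted to any sublattice.\<close>

lemma commuting_filtration_G: "commuting_filtration M K G"
  using commuting by (auto simp: commuting_filtration_def G_def lattice_on_def)

text \<open>Covariance gives E(l) U^k g = U^k E(l - k) g, which reduces all pairs \<open>k\<close>,
  \<open>l\<close> to conditioning \<open>g\<close> itself. \<open>X\<close> is prescribed only on
  \<open>space M\<close>, so that both \<open>U_op\<close> and \<open>U_on\<close> fit.\<close>

lemma orthomartingale_diff_orbit:
  assumes X: "\<And>k \<omega>. k \<in> lattice_on K \<Longrightarrow> \<omega> \<in> space M \<Longrightarrow> X k \<omega> = g (T k \<omega>)"
    and g: "g \<in> borel_measurable N" "integrable M g"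
    and zero: "\<And>j. j \<in> lattice_on K \<Longrightarrow> \<not> 0 \<le> j \<Longrightarrow> AE \<omega> in M. E j g \<omega> = 0"
  shows "orthomartingale_diff M K X"
  unfolding orthomartingale_diff_def
proof (intro exI[of _ G] conjI commuting_filtration_G ballI impI)
  fix k l assume kl: "k \<in> lattice_on K" "l \<in> lattice_on K" "\<not> k \<le> l"
  have g0: "g \<in> borel_measurable (G 0)" using g(1) sets_G_0 by (simp cong: measurable_cong_sets)
  have "(\<lambda>\<omega>. g (T k \<omega>)) \<in> borel_measurable (G k)"
    using measurable_compose[OF T_measurable_G[of k 0] g0] by simp
  then have Xm: "X k \<in> borel_measurable (G k)"
    using X[OF kl(1)] measurable_cong[of "G k" "X k" "\<lambda>\<omega>. g (T k \<omega>)" borel] by simp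
  have Xm': "X k \<in> borel_measurable M" by (rule measurable_from_subalg[OF subalgebra_G Xm])
  have int: "integrable M (\<lambda>\<omega>. g (T k \<omega>))" by (rule integrable_comp_T[OF g(2)])
  have Xint: "integrable M (X k)"
    using int X[OF kl(1)] by (simp cong: Bochner_Integration.integrable_cong)
  have "l - k \<in> lattice_on K" "\<not> 0 \<le> l - k" using kl by (auto simp: lattice_on_def less_eq_vec_def)
  \<comment> \<open>Measure preservation carries the exceptional null set back along
    \<open>T k\<close>.\<close>
  then have "AE \<omega> in distr M M (T k). E (l - k) g \<omega> = 0" unfolding distr_T by (rule zero)
  from AE_distrD[OF T_measurable this] have "AE \<omega> in M. E (l - k) g (T k \<omega>) = 0" .
  moreover have "AE \<omega> in M. E l (\<lambda>\<omega>. g (T k \<omega>)) \<omega> = E (l - k) g (T k \<omega>)"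
    using E_comp_T[OF g(2), of "l - k" k] by simp
  moreover have "AE \<omega> in M. E l (X k) \<omega> = E l (\<lambda>\<omega>. g (T k \<omega>)) \<omega>"
    by (rule E_cong_space) (use X[OF kl(1)] Xm' in auto)
  ultimately have "AE \<omega> in M. E l (X k) \<omega> = 0" by eventually_elim simp
  then show "X k \<in> Lp_ominus M (G k) (G l) 1"
    using Xm Xint by (simp add: Lp_ominus_def Lp_space_def)
qed

text \<open>This is m_J. Products of conditional expectations multiply out only almost surely; the
  expanded sum is one definite function and requires no order of the factors.\<close>

definition defect :: "('a \<Rightarrow> real) \<Rightarrow> 'd set \<Rightarrow> 'a \<Rightarrow> real" where
  "defect h J \<omega> = (\<Sum>B\<in>Pow (- J). (-1) ^ card B * E (- ind_vec (B \<union> J)) h \<omega>)"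

text \<open>Every index -1_B is below 0, so each term is measurable for \<open>G 0\<close>, which
  has the sets of \<open>N\<close>.\<close>

lemma defect_Lp:
  assumes p: "p \<ge> 1" and h: "h \<in> Lp_space M M p"
  shows "defect h J \<in> Lp_space M N p"
proof -
  have "E (- ind_vec B) h \<in> Lp_space M N p" for B
  proof -
    have "subalgebra (G 0) (G (- ind_vec B))"
      by (rule subalgebra_G_mono) (simp add: ind_vec_def less_eq_vec_def)
    then have sub: "subalgebra N (G (- ind_vec B))" by (simp add: subalgebra_def sets_G_0 space_N)
    have "E (- ind_vec B) h \<in> Lp_space M (G (- ind_vec B)) p"
      by (rule real_cond_exp_Lp(1)[OF prob_space_axioms subalgebra_G p h])
    then show ?thesis by (rule Lp_space_subalgebra[OF sub])
  qed
  then show ?thesis unfolding defect_def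
    by (intro Lp_space_sum[OF p subalgebra_N])
qed

lemma E_defect_eq_0:
  assumes h: "integrable M h" and j: "j \<in> lattice_on (- J)" "\<not> 0 \<le> j"
  shows "AE \<omega> in M. E j (defect h J) \<omega> = 0"
proof -
  obtain s where s: "j $ s < 0" using j(2) by (auto simp: less_eq_vec_def not_le)
  then have sJ: "s \<in> - J" using j(1) by (force simp: lattice_on_def)
  have "AE \<omega> in M. E j (defect h J) \<omega>
      = (\<Sum>B\<in>Pow (- J). E j (\<lambda>\<omega>. (-1) ^ card B * E (- ind_vec (B \<union> J)) h \<omega>) \<omega>)"
    unfolding defect_def
    by (rule sigma_finite_subalgebra.real_cond_exp_sum[OF sigma_finite_G])
      (intro integrable_mult_right E_integrable h)
  moreover have "AE \<omega> in M. \<forall>B\<in>Pow (- J). E j (\<lambda>\<omega>. (-1) ^ card B * E (- ind_vec (B \<union> J)) h \<omega>) \<omega>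
      = (-1) ^ card B * E (vmin (- ind_vec (B \<union> J)) j) h \<omega>"
  proof (rule AE_finite_allI)
    fix B
    have "AE \<omega> in M. E j (\<lambda>\<omega>. (-1) ^ card B * E (- ind_vec (B \<union> J)) h \<omega>) \<omega>
        = (-1) ^ card B * E j (E (- ind_vec (B \<union> J)) h) \<omega>"
      by (rule sigma_finite_subalgebra.real_cond_exp_cmult[OF sigma_finite_G E_integrable[OF h]])
    then show "AE \<omega> in M. E j (\<lambda>\<omega>. (-1) ^ card B * E (- ind_vec (B \<union> J)) h \<omega>) \<omega>
      = (-1) ^ card B * E (vmin (- ind_vec (B \<union> J)) j) h \<omega>"
      using E_commute[OF h, of j "- ind_vec (B \<union> J)"] by eventually_elim simp
  qed simp
  ultimately show ?thesis
  proof eventually_elim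
    case (elim \<omega>)
    \<comment> \<open>Integrality gives j_s <= -1, so the minimum at \<open>s\<close> is j_s whether
      or not \<open>s\<close> belongs to \<open>B\<close>.\<close>
    have "vmin (- ind_vec (insert s B \<union> J)) j = vmin (- ind_vec (B \<union> J)) j" for B
      using s by (auto simp: vmin_def ind_vec_def vec_eq_iff)
    then have "(\<Sum>B\<in>Pow (- J). (-1) ^ card B * E (vmin (- ind_vec (B \<union> J)) j) h \<omega>) = 0"
      by (intro sum_Pow_alternating_eq_0[OF _ sJ]) auto
    then show ?case using elim by simp
  qed
qed

text \<open>Covariance rewrites E(0) U^(1_K) h as U^(1_K) E(-1_K) h; at almost every point the claim
  is then \<open>sum_alternating_nested\<close>.\<close>

lemma sum_prod_I_minus_U_defect:
  assumes h: "integrable M h"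
  shows "AE \<omega> in M. (\<Sum>J\<in>UNIV. prod_I_minus_U M T J (defect h J) \<omega>)
    = (\<Sum>K\<in>UNIV. (-1) ^ card K * E 0 (\<lambda>\<omega>. h (T (ind_vec K) \<omega>)) \<omega>)"
proof -
  have "AE \<omega> in M. \<forall>K\<in>UNIV. E 0 (\<lambda>\<omega>. h (T (ind_vec K) \<omega>)) \<omega> = E (- ind_vec K) h (T (ind_vec K) \<omega>)"
  proof (rule AE_finite_allI)
    fix K :: "'d set"
    show "AE \<omega> in M. E 0 (\<lambda>\<omega>. h (T (ind_vec K) \<omega>)) \<omega> = E (- ind_vec K) h (T (ind_vec K) \<omega>)"
      using E_comp_T[OF h, of "- ind_vec K" "ind_vec K"] by simp
  qed simp
  then show ?thesis
    using AE_space
  proof eventually_elim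
    case (elim \<omega>)
    have "(\<Sum>J\<in>UNIV. prod_I_minus_U M T J (defect h J) \<omega>)
      = (\<Sum>J\<in>UNIV. \<Sum>K\<in>Pow J. (-1) ^ card K *
          (\<Sum>B\<in>Pow (- J). (-1) ^ card B * E (- ind_vec (B \<union> J)) h (T (ind_vec K) \<omega>)))"
      by (simp only: prod_I_minus_U_eq[OF elim(2)] defect_def)
    also have "\<dots> = (\<Sum>K\<in>UNIV. (-1) ^ card K * E (- ind_vec K) h (T (ind_vec K) \<omega>))"
      by (rule sum_alternating_nested)
    finally show ?case using elim(1) by simp
  qed
qed

end

subsection \<open>Inverting the product of the differences\<close>

context stationary_filtration
begin

definition proj_orbit :: "('a \<Rightarrow> real) \<Rightarrow> ('d \<Rightarrow> nat) \<Rightarrow> 'a \<Rightarrow> real" where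
  "proj_orbit f k = E 0 (\<lambda>\<omega>. f (T (int_vec k) \<omega>))"

lemma E_Lp: "p \<ge> 1 \<Longrightarrow> Z \<in> Lp_space M M p \<Longrightarrow> E i Z \<in> Lp_space M M p"
  by (rule Lp_space_subalgebra[OF subalgebra_G real_cond_exp_Lp(1)[OF prob_space_axioms subalgebra_G]])

lemma proj_orbit_Lp:
  assumes "p \<ge> 1" "f \<in> Lp_space M M p"
  shows "proj_orbit f k \<in> Lp_space M M p"
  unfolding proj_orbit_def by (intro E_Lp Lp_comp_T assms)

text \<open>By covariance \<open>proj_orbit f k\<close> is U^k E(-k) f, which has the norm of E(-k)
  f. Since -k <= -(k s) e_s, the tower property and contraction give the bound, with
  \<open>s\<close> free to choose.\<close>

lemma Lp_norm_proj_orbit_le: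
  assumes p: "p \<ge> 1" and f: "f \<in> Lp_space M M p"
  shows "Lp_norm M p (proj_orbit f k) \<le> Lp_norm M p (E (- axis s (int (k s))) f)"
proof -
  have int: "integrable M f" by (rule Lp_space_integrable[OF p f])
  have "Lp_norm M p (proj_orbit f k) = Lp_norm M p (\<lambda>\<omega>. E (- int_vec k) f (T (int_vec k) \<omega>))"
    unfolding proj_orbit_def
    using E_comp_T[OF int, of "- int_vec k" "int_vec k"] by (intro Lp_norm_cong_AE) auto
  also have "\<dots> = Lp_norm M p (E (- int_vec k) f)" by (rule Lp_comp_T(2)[OF E_Lp[OF p f]])
  also have "\<dots> = Lp_norm M p (E (- int_vec k) (E (- axis s (int (k s))) f))"
  proof (rule Lp_norm_cong_AE)
    have "- int_vec k \<le> - axis s (int (k s))" by (auto simp: int_vec_def less_eq_vec_def axis_def)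
    from E_tower[OF this int]
    show "AE \<omega> in M. E (- int_vec k) f \<omega> = E (- int_vec k) (E (- axis s (int (k s))) f) \<omega>"
      by eventually_elim simp
  qed auto
  also have "\<dots> \<le> Lp_norm M p (E (- axis s (int (k s))) f)"
    by (rule real_cond_exp_Lp(2)[OF prob_space_axioms subalgebra_G p E_Lp[OF p f]])
  finally show ?thesis .
qed

text \<open>Covariance turns the inner conditional expectation into one on
  \<open>G (ind_vec K)\<close>, and 0 <= 1_K lets the tower property remove it.\<close>

lemma E_proj_orbit:
  assumes f: "integrable M f"
  shows "AE \<omega> in M. E 0 (\<lambda>\<omega>. proj_orbit f k (T (ind_vec K) \<omega>)) \<omega>
    = proj_orbit f (\<lambda>s. k s + of_bool (s \<in> K)) \<omega>"
proof -
  let ?i = "ind_vec K"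
  have vec: "int_vec (\<lambda>s. k s + of_bool (s \<in> K)) = int_vec k + ?i"
    by (simp add: int_vec_def ind_vec_def vec_eq_iff)
  note [measurable] = borel_measurable_integrable[OF f]
  have fk: "integrable M (\<lambda>\<omega>. f (T (int_vec k) \<omega>))" by (rule integrable_comp_T[OF f])
  have fki: "integrable M (\<lambda>\<omega>. f (T (int_vec k) (T ?i \<omega>)))" by (rule integrable_comp_T[OF fk])
  have "AE \<omega> in M. proj_orbit f k (T ?i \<omega>) = E ?i (\<lambda>\<omega>. f (T (int_vec k) (T ?i \<omega>))) \<omega>"
    unfolding proj_orbit_def using E_comp_T[OF fk, of 0 ?i] by eventually_elim simp
  then have "AE \<omega> in M. E 0 (\<lambda>\<omega>. proj_orbit f k (T ?i \<omega>)) \<omega>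
      = E 0 (E ?i (\<lambda>\<omega>. f (T (int_vec k) (T ?i \<omega>)))) \<omega>"
    by (rule sigma_finite_subalgebra.real_cond_exp_cong[OF sigma_finite_G]) (simp_all add: proj_orbit_def)
  moreover have "AE \<omega> in M. E 0 (E ?i (\<lambda>\<omega>. f (T (int_vec k) (T ?i \<omega>)))) \<omega>
      = E 0 (\<lambda>\<omega>. f (T (int_vec k) (T ?i \<omega>))) \<omega>"
    by (rule E_tower[OF ind_vec_nonneg fki])
  moreover have "AE \<omega> in M. E 0 (\<lambda>\<omega>. f (T (int_vec k) (T ?i \<omega>))) \<omega>
      = proj_orbit f (\<lambda>s. k s + of_bool (s \<in> K)) \<omega>"
    unfolding proj_orbit_def vec by (rule E_cong_space) (simp_all add: T_add)
  ultimately show ?thesis by eventually_elim simp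
qed

text \<open>Telescoping applied pointwise. The corner \<open>A = {}\<close> is E(0) f = f, because
  \<open>f\<close> is measurable for \<open>N\<close>; the other corners form the remainder.\<close>

lemma proj_orbit_cube_telescope:
  assumes f: "f \<in> borel_measurable N" "integrable M f" and n: "n > 0"
  shows "AE \<omega> in M. (\<Sum>K\<in>UNIV. (-1) ^ card K *
      E 0 (\<lambda>\<omega>. \<Sum>k\<in>cube n. proj_orbit f k (T (ind_vec K) \<omega>)) \<omega>)
    = f \<omega> + (\<Sum>A\<in>UNIV - {{}}. (-1) ^ card A * proj_orbit f (\<lambda>s. n * of_bool (s \<in> A)) \<omega>)"
proof -
  have a_int: "integrable M (proj_orbit f k)" for k
    unfolding proj_orbit_def by (intro E_integrable integrable_comp_T f)
  have "AE \<omega> in M. \<forall>K\<in>UNIV. E 0 (\<lambda>\<omega>. \<Sum>k\<in>cube n. proj_orbit f k (T (ind_vec K) \<omega>)) \<omega>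
      = (\<Sum>k\<in>cube n. proj_orbit f (\<lambda>s. k s + of_bool (s \<in> K)) \<omega>)"
  proof (rule AE_finite_allI)
    fix K :: "'d set"
    have "AE \<omega> in M. E 0 (\<lambda>\<omega>. \<Sum>k\<in>cube n. proj_orbit f k (T (ind_vec K) \<omega>)) \<omega>
      = (\<Sum>k\<in>cube n. E 0 (\<lambda>\<omega>. proj_orbit f k (T (ind_vec K) \<omega>)) \<omega>)"
      by (rule sigma_finite_subalgebra.real_cond_exp_sum[OF sigma_finite_G integrable_comp_T[OF a_int]])
    moreover have "AE \<omega> in M. \<forall>k\<in>cube n. E 0 (\<lambda>\<omega>. proj_orbit f k (T (ind_vec K) \<omega>)) \<omega>
      = proj_orbit f (\<lambda>s. k s + of_bool (s \<in> K)) \<omega>"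
      by (rule AE_finite_allI[OF finite_cube E_proj_orbit[OF f(2)]])
    ultimately show "AE \<omega> in M. E 0 (\<lambda>\<omega>. \<Sum>k\<in>cube n. proj_orbit f k (T (ind_vec K) \<omega>)) \<omega>
      = (\<Sum>k\<in>cube n. proj_orbit f (\<lambda>s. k s + of_bool (s \<in> K)) \<omega>)"
      by eventually_elim simp
  qed simp
  moreover have "AE \<omega> in M. proj_orbit f (\<lambda>s. 0) \<omega> = f \<omega>"
  proof -
    have "int_vec (\<lambda>s. 0) = (0 :: int ^ 'd)" by (simp add: int_vec_def vec_eq_iff)
    then have "AE \<omega> in M. proj_orbit f (\<lambda>s. 0) \<omega> = E 0 f \<omega>"
      unfolding proj_orbit_def using borel_measurable_integrable[OF f(2)]
      by (intro E_cong_space) (simp_all add: T_zero)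
    moreover have "AE \<omega> in M. E 0 f \<omega> = f \<omega>"
      by (rule sigma_finite_subalgebra.real_cond_exp_F_meas[OF sigma_finite_G f(2)])
        (use f(1) sets_G_0 in \<open>simp cong: measurable_cong_sets\<close>)
    ultimately show ?thesis by eventually_elim simp
  qed
  ultimately show ?thesis
  proof eventually_elim
    case (elim \<omega>)
    have "(\<Sum>K\<in>UNIV. (-1) ^ card K * E 0 (\<lambda>\<omega>. \<Sum>k\<in>cube n. proj_orbit f k (T (ind_vec K) \<omega>)) \<omega>)
      = (\<Sum>A\<in>UNIV. (-1) ^ card A * proj_orbit f (\<lambda>s. n * of_bool (s \<in> A)) \<omega>)"
      using elim(1) sum_cube_telescope[OF n, of "\<lambda>k. proj_orbit f k \<omega>"] by simp
    also have "\<dots> = proj_orbit f (\<lambda>s. 0) \<omega>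
        + (\<Sum>A\<in>UNIV - {{}}. (-1) ^ card A * proj_orbit f (\<lambda>s. n * of_bool (s \<in> A)) \<omega>)"
      by (subst sum.remove[of UNIV "{}"]) auto
    finally show ?case using elim(2) by simp
  qed
qed

text \<open>\<open>h\<close> is the sum of all \<open>proj_orbit f k\<close>, and the equation is
  the L^1 limit of the telescoped identity over growing cubes.\<close>

lemma coboundary_equation:
  assumes p: "p \<ge> 1" and f: "f \<in> Lp_space M N p"
    and sm: "\<And>s. summable (\<lambda>k. real (Suc k) ^ (CARD('d) - 1) * Lp_norm M p (E (- axis s (int (Suc k))) f))"
  obtains h where "h \<in> Lp_space M M p"
    and "AE \<omega> in M. f \<omega> = (\<Sum>K\<in>UNIV. (-1) ^ card K * E 0 (\<lambda>\<omega>. h (T (ind_vec K) \<omega>)) \<omega>)"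
proof -
  let ?a = "proj_orbit f"
  have fM: "f \<in> Lp_space M M p"
    by (rule Lp_space_subalgebra[OF subalgebra_N f])
  have f_int: "integrable M f" by (rule Lp_space_integrable[OF p fM])
  have a_Lp: "?a k \<in> Lp_space M M p" for k by (rule proj_orbit_Lp[OF p fM])
  have a_int: "integrable M (?a k)" for k by (rule Lp_space_integrable[OF p a_Lp])
  \<comment> \<open>Summing over \<open>s\<close> gives one bound that works whichever coordinate of
    \<open>k\<close> is the largest.\<close>
  define b where "b = (\<lambda>n. \<Sum>s\<in>UNIV. Lp_norm M p (E (- axis s (int n)) f))"
  have b_nonneg: "0 \<le> b n" for n by (simp add: b_def sum_nonneg)
  have a_le: "Lp_norm M p (?a k) \<le> b (k s)" for k s
  proof -
    have "Lp_norm M p (?a k) \<le> Lp_norm M p (E (- axis s (int (k s))) f)"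
      by (rule Lp_norm_proj_orbit_le[OF p fM])
    also have "\<dots> \<le> b (k s)" unfolding b_def by (rule member_le_sum) auto
    finally show ?thesis .
  qed
  \<comment> \<open>The weight (n + 1)^(d-1) at \<open>b n\<close> is one step ahead of the
    hypothesis, which puts it at the norm for n + 1. After dropping the term at 0, n + 2 <= 2 (n +
    1) costs only the factor 2^(d-1).\<close>
  have sum_b: "summable (\<lambda>n. real (Suc n) ^ (CARD('d) - 1) * b n)"
  proof (subst summable_Suc_iff[symmetric], rule summable_comparison_test')
    show "summable (\<lambda>n. 2 ^ (CARD('d) - 1) * (\<Sum>s\<in>UNIV. real (Suc n) ^ (CARD('d) - 1)
        * Lp_norm M p (E (- axis s (int (Suc n))) f)))"
      by (intro summable_mult summable_sum sm)
    fix n :: nat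
    have "real (Suc (Suc n)) ^ (CARD('d) - 1) \<le> (2 * real (Suc n)) ^ (CARD('d) - 1)"
      by (rule power_mono) auto
    then have "real (Suc (Suc n)) ^ (CARD('d) - 1) * b (Suc n)
        \<le> 2 ^ (CARD('d) - 1) * real (Suc n) ^ (CARD('d) - 1) * b (Suc n)"
      by (intro mult_right_mono b_nonneg) (simp only: power_mult_distrib)
    then show "norm (real (Suc (Suc n)) ^ (CARD('d) - 1) * b (Suc n))
        \<le> 2 ^ (CARD('d) - 1) * (\<Sum>s\<in>UNIV. real (Suc n) ^ (CARD('d) - 1)
        * Lp_norm M p (E (- axis s (int (Suc n))) f))"
      using b_nonneg[of "Suc n"] by (simp add: b_def sum_distrib_left[symmetric] mult.assoc del: of_nat_Suc)
  qed
  \<comment> \<open>The weights are at least 1; the resulting limit of \<open>b\<close> will remove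
    the corner terms.\<close>
  have "summable b"
  proof (rule summable_comparison_test'[OF sum_b])
    fix n :: nat
    show "norm (b n) \<le> real (Suc n) ^ (CARD('d) - 1) * b n"
      using mult_right_mono[OF one_le_power[of "real (Suc n)" "CARD('d) - 1"] b_nonneg[of n]] b_nonneg[of n]
      by simp
  qed
  then have b_lim: "b \<longlonglongrightarrow> 0" by (rule summable_LIMSEQ_zero)
  define c where "c = (\<lambda>n \<omega>. \<Sum>k\<in>shell n. ?a k \<omega>)"
  have c_Lp: "c n \<in> Lp_space M M p" for n
    using Lp_space_sum[OF p, of M M "shell n" ?a "\<lambda>_. 1"] a_Lp by (simp add: c_def subalgebra_def)
  \<comment> \<open>Every index in shell \<open>n\<close> has some coordinate equal to
    \<open>n\<close>, so each of its terms is bounded by \<open>b n\<close>.\<close>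
  have c_le: "Lp_norm M p (c n) \<le> real CARD('d) * (real (Suc n) ^ (CARD('d) - 1) * b n)" for n
  proof -
    have "Lp_norm M p (c n) \<le> (\<Sum>k\<in>shell n. Lp_norm M p (?a k))"
      unfolding c_def by (rule Lp_norm_sum_le[OF p _ a_Lp]) simp
    also have "\<dots> \<le> real (card (shell n :: ('d \<Rightarrow> nat) set)) * b n"
    proof (rule sum_bounded_above)
      fix k :: "'d \<Rightarrow> nat" assume "k \<in> shell n"
      then show "Lp_norm M p (?a k) \<le> b n" using shell_attains[of k n] a_le[of k] by auto
    qed
    also have "\<dots> \<le> real (CARD('d) * Suc n ^ (CARD('d) - 1)) * b n"
      by (intro mult_right_mono b_nonneg of_nat_mono card_shell_le)
    finally show ?thesis by (simp add: mult.assoc)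
  qed
  have sum_c: "summable (\<lambda>n. Lp_norm M p (c n))"
    by (rule summable_comparison_test'[OF summable_mult[OF sum_b, of "real CARD('d)"]])
      (use c_le in \<open>simp del: of_nat_Suc\<close>)
  define h where "h = (\<lambda>\<omega>. \<Sum>n. c n \<omega>)"
  have h_Lp: "h \<in> Lp_space M M p" unfolding h_def by (rule Lp_series(1)[OF p c_Lp sum_c])
  have h_int: "integrable M h" by (rule Lp_space_integrable[OF p h_Lp])
  define H where "H = (\<lambda>n \<omega>. \<Sum>k\<in>cube n. ?a k \<omega>)"
  have H_int: "integrable M (H n)" for n unfolding H_def by (intro Bochner_Integration.integrable_sum a_int)
  have H_lim: "(\<lambda>n. \<integral>\<omega>. \<bar>h \<omega> - H n \<omega>\<bar> \<partial>M) \<longlonglongrightarrow> 0"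
    using Lp_series(2)[OF p c_Lp sum_c] by (simp add: h_def H_def c_def sum_cube_eq_sum_shell)
  \<comment> \<open>The right-hand side as an operator: at \<open>H n\<close> it is given by the
    telescoped identity, and its change from \<open>H n\<close> to \<open>h\<close> is controlled in
    L^1.\<close>
  let ?\<Phi> = "\<lambda>Z \<omega>. \<Sum>K\<in>UNIV. (-1) ^ card K * E 0 (\<lambda>\<omega>. Z (T (ind_vec K) \<omega>)) \<omega>"
  have \<Phi>_int: "integrable M (?\<Phi> Z)" if "integrable M Z" for Z
    by (intro Bochner_Integration.integrable_sum integrable_mult_right E_integrable integrable_comp_T that)
  have "AE \<omega> in M. f \<omega> = ?\<Phi> h \<omega>"
  proof (rule AE_eq_of_integral_abs_diff_le[OF f_int \<Phi>_int[OF h_int]])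
    fix n :: nat assume n: "n > 0"
    let ?D = "\<lambda>K \<omega>. \<bar>E 0 (\<lambda>\<omega>. h (T (ind_vec K) \<omega>)) \<omega> - E 0 (\<lambda>\<omega>. H n (T (ind_vec K) \<omega>)) \<omega>\<bar>"
    let ?R = "\<lambda>A. ?a (\<lambda>s. n * of_bool (s \<in> A))"
    have D_int: "integrable M (?D K)" for K
      by (intro integrable_abs Bochner_Integration.integrable_diff E_integrable integrable_comp_T h_int H_int)
    have R_int: "integrable M (\<lambda>\<omega>. \<bar>?R A \<omega>\<bar>)" for A by (intro integrable_abs a_int)
    \<comment> \<open>The error splits into one contraction term for each \<open>K\<close> and one
      corner term for each nonempty \<open>A\<close>.\<close>
    have "(\<integral>\<omega>. \<bar>f \<omega> - ?\<Phi> h \<omega>\<bar> \<partial>M)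
      \<le> (\<integral>\<omega>. (\<Sum>K\<in>UNIV. ?D K \<omega>) + (\<Sum>A\<in>UNIV - {{}}. \<bar>?R A \<omega>\<bar>) \<partial>M)"
    proof (rule integral_mono_AE)
      have "AE \<omega> in M. ?\<Phi> (H n) \<omega> = f \<omega> + (\<Sum>A\<in>UNIV - {{}}. (-1) ^ card A * ?R A \<omega>)"
        using proj_orbit_cube_telescope[OF _ f_int n] f by (simp add: H_def Lp_space_def)
      then show "AE \<omega> in M. \<bar>f \<omega> - ?\<Phi> h \<omega>\<bar> \<le> (\<Sum>K\<in>UNIV. ?D K \<omega>) + (\<Sum>A\<in>UNIV - {{}}. \<bar>?R A \<omega>\<bar>)"
      proof eventually_elim
        case (elim \<omega>)
        have "\<bar>?\<Phi> h \<omega> - ?\<Phi> (H n) \<omega>\<bar> \<le> (\<Sum>K\<in>UNIV. ?D K \<omega>)"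
          unfolding sum_subtractf[symmetric] right_diff_distrib[symmetric]
          by (rule order_trans[OF sum_abs]) (simp add: abs_mult)
        moreover have "\<bar>\<Sum>A\<in>UNIV - {{}}. (-1) ^ card A * ?R A \<omega>\<bar> \<le> (\<Sum>A\<in>UNIV - {{}}. \<bar>?R A \<omega>\<bar>)"
          by (rule order_trans[OF sum_abs]) (simp add: abs_mult)
        ultimately show ?case using elim by linarith
      qed
    qed (intro Bochner_Integration.integrable_add Bochner_Integration.integrable_sum integrable_abs
        Bochner_Integration.integrable_diff f_int \<Phi>_int h_int D_int a_int)+
    also have "\<dots> = (\<Sum>K\<in>UNIV. \<integral>\<omega>. ?D K \<omega> \<partial>M) + (\<Sum>A\<in>UNIV - {{}}. \<integral>\<omega>. \<bar>?R A \<omega>\<bar> \<partial>M)"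
      by (subst Bochner_Integration.integral_add)
        (intro Bochner_Integration.integrable_sum D_int R_int, intro Bochner_Integration.integrable_sum D_int R_int,
          simp add: D_int R_int Bochner_Integration.integral_sum)
    also have "\<dots> \<le> (\<Sum>K\<in>(UNIV :: 'd set set). \<integral>\<omega>. \<bar>h \<omega> - H n \<omega>\<bar> \<partial>M) + (\<Sum>A\<in>UNIV - {{} :: 'd set}. b n)"
    proof (intro add_mono sum_mono)
      fix K :: "'d set"
      have "(\<integral>\<omega>. ?D K \<omega> \<partial>M) \<le> (\<integral>\<omega>. \<bar>h (T (ind_vec K) \<omega>) - H n (T (ind_vec K) \<omega>)\<bar> \<partial>M)"
        by (intro E_L1_contraction integrable_comp_T h_int H_int)
      also have "\<dots> = (\<integral>\<omega>. \<bar>h \<omega> - H n \<omega>\<bar> \<partial>M)"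
        by (rule integral_comp_T[of "\<lambda>\<omega>. \<bar>h \<omega> - H n \<omega>\<bar>"])
          (use h_int H_int[of n] in \<open>auto intro!: borel_measurable_abs borel_measurable_diff\<close>)
      finally show "(\<integral>\<omega>. ?D K \<omega> \<partial>M) \<le> (\<integral>\<omega>. \<bar>h \<omega> - H n \<omega>\<bar> \<partial>M)" .
    next
      fix A :: "'d set" assume "A \<in> UNIV - {{}}"
      then obtain s where "s \<in> A" by auto
      have "(\<integral>\<omega>. \<bar>?R A \<omega>\<bar> \<partial>M) \<le> Lp_norm M p (?R A)" by (rule integral_abs_le_Lp_norm[OF p a_Lp])
      \<comment> \<open>The corner has coordinate \<open>n\<close> at every \<open>s\<close> in
        \<open>A\<close>, hence the bound \<open>b n\<close>.\<close>
      also have "\<dots> \<le> b n" using a_le[of "\<lambda>s. n * of_bool (s \<in> A)" s] \<open>s \<in> A\<close> by simp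
      finally show "(\<integral>\<omega>. \<bar>?R A \<omega>\<bar> \<partial>M) \<le> b n" .
    qed
    finally show "(\<integral>\<omega>. \<bar>f \<omega> - ?\<Phi> h \<omega>\<bar> \<partial>M)
      \<le> real CARD('d set) * (\<integral>\<omega>. \<bar>h \<omega> - H n \<omega>\<bar> \<partial>M) + real (card (UNIV - {{} :: 'd set})) * b n"
      by simp
  next
    show "(\<lambda>n. real CARD('d set) * (\<integral>\<omega>. \<bar>h \<omega> - H n \<omega>\<bar> \<partial>M)
        + real (card (UNIV - {{} :: 'd set})) * b n) \<longlonglongrightarrow> 0"
      by (intro tendsto_add_zero tendsto_mult_right_zero H_lim b_lim)
  qed
  with h_Lp show thesis by (rule that)
qed

end

section \<open>Assembly of the decomposition from the components of \<open>h\<close>\<close>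

theorem theorem1:
  fixes M N :: "'a measure"
    and T :: "int ^ 'd::finite \<Rightarrow> 'a \<Rightarrow> 'a"
    and f :: "'a \<Rightarrow> real"
    and p :: real
  assumes "prob_space M"
    and "measure_preserving_action M T"
    and "p \<ge> 1"
    and "subalgebra M N"
    and "commuting_filtration M UNIV (\<lambda>i. shift_alg M T N (- i))"
    and "\<And>s. f \<in> Lp_ominus M N (tail_alg M T N s) p"
    and "\<And>s. summable (\<lambda>k. real (Suc k) ^ (CARD('d) - 1) *
             Lp_norm M p (real_cond_exp M (shift_alg M T N (axis s (int (Suc k)))) f))"
  shows "\<exists>m g mJ.
    m \<in> Lp_space M N p \<and> g \<in> Lp_space M N p \<and>
    (\<forall>J. {} \<subset> J \<and> J \<subset> UNIV \<longrightarrow> mJ J \<in> Lp_space M N p) \<and>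
    (AE \<omega> in M. f \<omega> = m \<omega> + (\<Sum>J | {} \<subset> J \<and> J \<subset> UNIV. prod_I_minus_U M T J (mJ J) \<omega>)
                     + prod_I_minus_U M T UNIV g \<omega>) \<and>
    orthomartingale_diff M UNIV (\<lambda>i. U_op M T i m) \<and>
    (\<forall>J. {} \<subset> J \<and> J \<subset> UNIV \<longrightarrow> orthomartingale_diff M (- J) (\<lambda>i. U_on M T (- J) i (mJ J)))"
proof -
  interpret prob_space M by fact
  interpret stationary_filtration M N T by unfold_locales fact+
  have fN: "f \<in> Lp_space M N p" using assms(6) by (simp add: Lp_ominus_def)
  have sm: "summable (\<lambda>k. real (Suc k) ^ (CARD('d) - 1) * Lp_norm M p (E (- axis s (int (Suc k))) f))" for s
    using assms(7)[of s] by (simp add: G_def)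
  obtain h where h: "h \<in> Lp_space M M p"
    and eq: "AE \<omega> in M. f \<omega> = (\<Sum>K\<in>UNIV. (-1) ^ card K * E 0 (\<lambda>\<omega>. h (T (ind_vec K) \<omega>)) \<omega>)"
    by (rule coboundary_equation[OF assms(3) fN sm])
  have h_int: "integrable M h" by (rule Lp_space_integrable[OF assms(3) h])
  have Lp: "defect h J \<in> Lp_space M N p" for J by (rule defect_Lp[OF assms(3) h])
  \<comment> \<open>One statement covers all fields: \<open>J = {}\<close> gives that of
    \<open>m\<close> on the full lattice, as \<open>- {}\<close> is \<open>UNIV\<close>.\<close>
  have ortho: "orthomartingale_diff M (- J) X"
    if "\<And>k \<omega>. k \<in> lattice_on (- J) \<Longrightarrow> \<omega> \<in> space M \<Longrightarrow> X k \<omega> = defect h J (T k \<omega>)" for J X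
  proof (rule orthomartingale_diff_orbit[where g = "defect h J"])
    show "defect h J \<in> borel_measurable N" using Lp by (simp add: Lp_space_def)
    show "integrable M (defect h J)"
      by (rule Lp_space_integrable[OF assms(3) Lp_space_subalgebra[OF subalgebra_N Lp]])
  qed (auto intro: that E_defect_eq_0[OF h_int])
  \<comment> \<open>The coordinate type is inhabited, so \<open>{}\<close> and \<open>UNIV\<close>
    differ and give the separate terms for \<open>m\<close> and \<open>g\<close>.\<close>
  have sum_split: "(\<Sum>J\<in>UNIV. F J) = F {} + (\<Sum>J | {} \<subset> J \<and> J \<subset> UNIV. F J) + F UNIV" for F :: "'d set \<Rightarrow> real"
  proof -
    have "UNIV = insert {} (insert UNIV {J. {} \<subset> J \<and> J \<subset> (UNIV :: 'd set)})" by auto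
    then have "(\<Sum>J\<in>UNIV. F J) = sum F (insert {} (insert UNIV {J. {} \<subset> J \<and> J \<subset> UNIV}))" by simp
    also have "\<dots> = F {} + (\<Sum>J | {} \<subset> J \<and> J \<subset> UNIV. F J) + F UNIV"
      by (subst sum.insert; simp)+
    finally show ?thesis .
  qed
  have empty: "prod_I_minus_U M T {} (defect h {}) = defect h {}" by (simp add: prod_I_minus_U_def)
  have "AE \<omega> in M. f \<omega> = defect h {} \<omega>
      + (\<Sum>J | {} \<subset> J \<and> J \<subset> UNIV. prod_I_minus_U M T J (defect h J) \<omega>)
      + prod_I_minus_U M T UNIV (defect h UNIV) \<omega>"
    using sum_prod_I_minus_U_defect[OF h_int] eq by eventually_elim (simp add: sum_split empty)
  moreover have "orthomartingale_diff M UNIV (\<lambda>i. U_op M T i (defect h {}))"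
    using ortho[of "{}"] by (simp add: U_op_def)
  moreover have "orthomartingale_diff M (- J) (\<lambda>i. U_on M T (- J) i (defect h J))" for J
    by (rule ortho) (rule U_on_lattice_eq)
  \<comment> \<open>The witnesses \<open>m\<close>, \<open>g\<close> and \<open>mJ J\<close> are
    \<open>defect h\<close> at \<open>{}\<close>, \<open>UNIV\<close> and \<open>J\<close>.\<close>
  ultimately show ?thesis using Lp by blast
qed

end
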